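(* Let $k\ge1$, let $\mathsf{F}$ be a field, and let $\Lambda$ be a row-finite $k$-graph without sources such that $|\Lambda^0|<\infty$. If $\Lambda$ satisfies both Conditions (HNE) and (HEDL), then the Kumjian--Pask algebra $\mathrm{KP}_{\mathsf{F}}(\Lambda)$ is a crossed product (as a $\mathbb{Z}^k$-graded algebra).
   Context: $\mathbb{N}=\{0,1,2,\dots\}$; $\mathbb{Z}^k$ has the coordinatewise order; $\mathbf{e}_i$ is the $i$-th unit vector. A $k$-graph is a countable small category $\Lambda$ with a functor $d:\Lambda\to\mathbb{N}^k$ (degree) such that whenever $d(\lambda)=\mathbf{n}+\mathbf{m}$ with $\mathbf{n},\mathbf{m}\in\mathbb{N}^k$ there are unique $\alpha,\beta\in\Lambda$ with $d(\alpha)=\mathbf{n}$, $d(\beta)=\mathbf{m}$, $\lambda=\alpha\beta$. The codomain and domain of a morphism (path) $\lambda$ are $r(\lambda)$ and $s(\lambda)$; $\lambda\mu$ is defined when $s(\lambda)=r(\mu)$. $\Lambda^{\mathbf{n}}=d^{-1}(\mathbf{n})$; elements of $\Lambda^0$ are identified with objects (vertices). $v\Lambda=\{\lambda:r(\lambda)=v\}$, $\Lambda v=\{\lambda:s(\lambda)=v\}$, $v\Lambda^{\mathbf{n}}=v\Lambda\cap\Lambda^{\mathbf{n}}$. $\Lambda$ is row-finite without sources if $0<|v\Lambda^{\mathbf{n}}|<\infty$ for all $v,\mathbf{n}$. For $0\le\mathbf{n}\le\mathbf{m}\le d(\lambda)$, $\lambda(\mathbf{n},\mathbf{m})$ is the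 unique path of degree $\mathbf{m}-\mathbf{n}$ with $\lambda=\alpha\lambda(\mathbf{n},\mathbf{m})\beta$, $d(\alpha)=\mathbf{n}$, $d(\beta)=d(\lambda)-\mathbf{m}$; $\lambda(\mathbf{n})=\lambda(\mathbf{n},\mathbf{n})$. If $d(\lambda)=(n_1,\dots,n_k)$ then $|\lambda|=\sum_i n_i$. A loop is a path $\mu$ with $r(\mu)=s(\mu)$; it is nontrivial if it is not a vertex. An entrance to a loop $\mu$ is a path $\lambda\in s(\mu)\Lambda$ with $d(\lambda)\le d(\mu)$ and $\mu(0,d(\lambda))\ne\lambda$. Condition (HNE): no loop in $\Lambda$ has an entrance. A nontrivial loop $\mu$ is a cycle if for $0\le\mathbf{n}<\mathbf{m}\le d(\mu)$, $\mu(\mathbf{n})=\mu(\mathbf{m})$ implies $\mathbf{n}=0$ and $\mathbf{m}=d(\mu)$. A path $\lambda$ is unicolor in degree $\mathbf{e}_i$ if $d(\lambda)=|\lambda|\mathbf{e}_i$. Let $\mathcal{C}_i$ be the set of cycles of $\Lambda$ that are unicolor in degree $\mathbf{e}_i$. For $\mu\in\mathcal{C}_i$ and $0\le t\le|\mu|-1$ let $\mathcal{O}^\mu_t$ be the set of all paths $\lambda\in\Lambda s(\mu)$ such that $\lambda$ is unicolor in degree $\mathbf{e}_i$, $|\lambda|\equiv t\pmod{|\mu|}$, and, whenever $d(\lambda)\ge d(\mu)$, $\lambda(\mathbf{n},\mathbf{n}+d(\mu))\neq\mu$ for all $0\le\mathbf{n}\le d(\lambda)-d(\mu)$. Condition (HEDL):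 for each $i=1,\dots,k$ and each $\mu\in\mathcal{C}_i$ there exists a positive integer $\ell^\mu$ with $|\mathcal{O}^\mu_t|=\ell^\mu$ for all $t=0,1,\dots,|\mu|-1$. $\mathrm{KP}_{\mathsf F}(\Lambda)$ is the universal associative $\mathsf{F}$-algebra generated by $p_v$ ($v\in\Lambda^0$), $s_\lambda,s_{\lambda^*}$ ($\lambda\in\Lambda\setminus\Lambda^0$) with relations: (KP1) $p_up_v=\delta_{u,v}p_u$; (KP2) $s_\lambda s_\mu=s_{\lambda\mu}$, $s_{\mu^*}s_{\lambda^*}=s_{(\lambda\mu)^*}$ when $s(\lambda)=r(\mu)$, $p_{r(\lambda)}s_\lambda=s_\lambda=s_\lambda p_{s(\lambda)}$, $p_{s(\lambda)}s_{\lambda^*}=s_{\lambda^*}=s_{\lambda^*}p_{r(\lambda)}$; (KP3) $s_{\lambda^*}s_\mu=\delta_{\lambda,\mu}p_{s(\lambda)}$ if $d(\lambda)=d(\mu)$; (KP4) $p_v=\sum_{\lambda\in v\Lambda^{\mathbf{n}}}s_\lambda s_{\lambda^*}$ for all $v$, $\mathbf{n}\ne0$. With $s_v=s_{v^*}=p_v$, it is $\mathbb{Z}^k$-graded with $\mathrm{KP}_{\mathsf F}(\Lambda)_{\mathbf{n}}=\mathrm{span}_{\mathsf F}\{s_\lambda s_{\mu^*}: d(\lambda)-d(\mu)=\mathbf{n}\}$; it is unital since $|\Lambda^0|<\infty$. A $\Gamma$-graded unital algebra $A=\bigoplus_{\gamma\in\Gamma}A_\gamma$ is a crossed product if every $A_\gamma$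 contains an invertible element of $A$. *)

theory Defs
  imports
    "HOL-Analysis.Finite_Cartesian_Product"
    "HOL-Library.Countable_Set"
    "HOL-Library.Poly_Mapping"
    "HOL-Algebra.Module"
    "HOL-Algebra.QuotRing"
    "HOL-Algebra.Algebraic_Closure_Type"
begin

section \<open>Higher-rank graphs\<close>

text \<open>
  Degrees live in \<^typ>\<open>nat ^ 'k\<close> with its coordinatewise order, where
  \<open>k = CARD('k) \<ge> 1\<close>; the unit vectors are \<open>axis i 1\<close>. Note that subtraction on
  \<^typ>\<open>nat ^ 'k\<close> is truncated; it is only used below where it is exact.

  Categories are presented by their morphisms alone: an object is the same as its identity
  morphism, so that range and source are maps from morphisms to identity morphisms.
  The composite \<open>cmp \<Lambda> \<nu> \<mu>\<close> is meaningful only if \<open>src \<Lambda> \<nu> = rng \<Lambda> \<mu>\<close>.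
\<close>

record ('a, 'k) kgraph =
  paths :: "'a set"
  rng :: "'a \<Rightarrow> 'a"
  src :: "'a \<Rightarrow> 'a"
  cmp :: "'a \<Rightarrow> 'a \<Rightarrow> 'a"
  dgr :: "'a \<Rightarrow> nat ^ 'k"

locale k_graph =
  fixes \<Lambda> :: "('a, 'k::finite) kgraph"
  assumes countable_paths: "countable (paths \<Lambda>)"
    and rng_closed: "\<nu> \<in> paths \<Lambda> \<Longrightarrow> rng \<Lambda> \<nu> \<in> paths \<Lambda>"
    and src_closed: "\<nu> \<in> paths \<Lambda> \<Longrightarrow> src \<Lambda> \<nu> \<in> paths \<Lambda>"
    and rng_rng: "\<nu> \<in> paths \<Lambda> \<Longrightarrow> rng \<Lambda> (rng \<Lambda> \<nu>) = rng \<Lambda> \<nu>"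
    and src_rng: "\<nu> \<in> paths \<Lambda> \<Longrightarrow> src \<Lambda> (rng \<Lambda> \<nu>) = rng \<Lambda> \<nu>"
    and rng_src: "\<nu> \<in> paths \<Lambda> \<Longrightarrow> rng \<Lambda> (src \<Lambda> \<nu>) = src \<Lambda> \<nu>"
    and src_src: "\<nu> \<in> paths \<Lambda> \<Longrightarrow> src \<Lambda> (src \<Lambda> \<nu>) = src \<Lambda> \<nu>"
    and cmp_closed: "\<lbrakk>\<nu> \<in> paths \<Lambda>; \<mu> \<in> paths \<Lambda>; src \<Lambda> \<nu> = rng \<Lambda> \<mu>\<rbrakk>
      \<Longrightarrow> cmp \<Lambda> \<nu> \<mu> \<in> paths \<Lambda>"
    and rng_cmp: "\<lbrakk>\<nu> \<in> paths \<Lambda>; \<mu> \<in> paths \<Lambda>; src \<Lambda> \<nu> = rng \<Lambda> \<mu>\<rbrakk>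
      \<Longrightarrow> rng \<Lambda> (cmp \<Lambda> \<nu> \<mu>) = rng \<Lambda> \<nu>"
    and src_cmp: "\<lbrakk>\<nu> \<in> paths \<Lambda>; \<mu> \<in> paths \<Lambda>; src \<Lambda> \<nu> = rng \<Lambda> \<mu>\<rbrakk>
      \<Longrightarrow> src \<Lambda> (cmp \<Lambda> \<nu> \<mu>) = src \<Lambda> \<mu>"
    and cmp_assoc: "\<lbrakk>\<nu> \<in> paths \<Lambda>; \<mu> \<in> paths \<Lambda>; \<rho> \<in> paths \<Lambda>;
        src \<Lambda> \<nu> = rng \<Lambda> \<mu>; src \<Lambda> \<mu> = rng \<Lambda> \<rho>\<rbrakk>
      \<Longrightarrow> cmp \<Lambda> (cmp \<Lambda> \<nu> \<mu>) \<rho> = cmp \<Lambda> \<nu> (cmp \<Lambda> \<mu> \<rho>)"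
    and cmp_rng: "\<nu> \<in> paths \<Lambda> \<Longrightarrow> cmp \<Lambda> (rng \<Lambda> \<nu>) \<nu> = \<nu>"
    and cmp_src: "\<nu> \<in> paths \<Lambda> \<Longrightarrow> cmp \<Lambda> \<nu> (src \<Lambda> \<nu>) = \<nu>"
    and dgr_rng: "\<nu> \<in> paths \<Lambda> \<Longrightarrow> dgr \<Lambda> (rng \<Lambda> \<nu>) = 0"
    and dgr_src: "\<nu> \<in> paths \<Lambda> \<Longrightarrow> dgr \<Lambda> (src \<Lambda> \<nu>) = 0"
    and dgr_cmp: "\<lbrakk>\<nu> \<in> paths \<Lambda>; \<mu> \<in> paths \<Lambda>; src \<Lambda> \<nu> = rng \<Lambda> \<mu>\<rbrakk>
      \<Longrightarrow> dgr \<Lambda> (cmp \<Lambda> \<nu> \<mu>) = dgr \<Lambda> \<nu> + dgr \<Lambda> \<mu>"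
    and unique_factorization: "\<lbrakk>\<nu> \<in> paths \<Lambda>; dgr \<Lambda> \<nu> = n + m\<rbrakk>
      \<Longrightarrow> \<exists>!p. fst p \<in> paths \<Lambda> \<and> snd p \<in> paths \<Lambda> \<and> src \<Lambda> (fst p) = rng \<Lambda> (snd p) \<and>
            dgr \<Lambda> (fst p) = n \<and> dgr \<Lambda> (snd p) = m \<and> \<nu> = cmp \<Lambda> (fst p) (snd p)"

text \<open>By unique factorization the paths of degree 0 are exactly the identity morphisms.\<close>

definition vertices :: "('a, 'k::finite) kgraph \<Rightarrow> 'a set" where
  "vertices \<Lambda> = {\<nu> \<in> paths \<Lambda>. dgr \<Lambda> \<nu> = 0}"

definition paths_from :: "('a, 'k::finite) kgraph \<Rightarrow> 'a \<Rightarrow> nat ^ 'k \<Rightarrow> 'a set" where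
  "paths_from \<Lambda> v n = {\<nu> \<in> paths \<Lambda>. rng \<Lambda> \<nu> = v \<and> dgr \<Lambda> \<nu> = n}"

definition row_finite_no_sources :: "('a, 'k::finite) kgraph \<Rightarrow> bool" where
  "row_finite_no_sources \<Lambda> \<longleftrightarrow>
     (\<forall>v \<in> vertices \<Lambda>. \<forall>n. paths_from \<Lambda> v n \<noteq> {} \<and> finite (paths_from \<Lambda> v n))"

text \<open>The path \<open>\<nu>(n, m)\<close>, meaningful for \<open>n \<le> m \<le> d(\<nu>)\<close>.\<close>

definition segment :: "('a, 'k::finite) kgraph \<Rightarrow> 'a \<Rightarrow> nat ^ 'k \<Rightarrow> nat ^ 'k \<Rightarrow> 'a" where
  "segment \<Lambda> \<nu> n m = (THE \<beta>. \<beta> \<in> paths \<Lambda> \<and> dgr \<Lambda> \<beta> = m - n \<and>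
     (\<exists>\<alpha> \<in> paths \<Lambda>. \<exists>\<gamma> \<in> paths \<Lambda>. src \<Lambda> \<alpha> = rng \<Lambda> \<beta> \<and> src \<Lambda> \<beta> = rng \<Lambda> \<gamma> \<and>
        dgr \<Lambda> \<alpha> = n \<and> dgr \<Lambda> \<gamma> = dgr \<Lambda> \<nu> - m \<and> \<nu> = cmp \<Lambda> (cmp \<Lambda> \<alpha> \<beta>) \<gamma>))"

definition path_length :: "('a, 'k::finite) kgraph \<Rightarrow> 'a \<Rightarrow> nat" where
  "path_length \<Lambda> \<nu> = (\<Sum>i\<in>UNIV. dgr \<Lambda> \<nu> $ i)"

definition is_loop :: "('a, 'k::finite) kgraph \<Rightarrow> 'a \<Rightarrow> bool" where
  "is_loop \<Lambda> \<mu> \<longleftrightarrow> \<mu> \<in> paths \<Lambda> \<and> rng \<Lambda> \<mu> = src \<Lambda> \<mu>"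

definition is_entrance :: "('a, 'k::finite) kgraph \<Rightarrow> 'a \<Rightarrow> 'a \<Rightarrow> bool" where
  "is_entrance \<Lambda> \<mu> \<nu> \<longleftrightarrow> \<nu> \<in> paths \<Lambda> \<and> rng \<Lambda> \<nu> = src \<Lambda> \<mu> \<and>
     dgr \<Lambda> \<nu> \<le> dgr \<Lambda> \<mu> \<and> segment \<Lambda> \<mu> 0 (dgr \<Lambda> \<nu>) \<noteq> \<nu>"

definition HNE :: "('a, 'k::finite) kgraph \<Rightarrow> bool" where
  "HNE \<Lambda> \<longleftrightarrow> (\<forall>\<mu>. is_loop \<Lambda> \<mu> \<longrightarrow> \<not> (\<exists>\<nu>. is_entrance \<Lambda> \<mu> \<nu>))"

definition is_cycle :: "('a, 'k::finite) kgraph \<Rightarrow> 'a \<Rightarrow> bool" where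
  "is_cycle \<Lambda> \<mu> \<longleftrightarrow> is_loop \<Lambda> \<mu> \<and> \<mu> \<notin> vertices \<Lambda> \<and>
     (\<forall>n m. n < m \<and> m \<le> dgr \<Lambda> \<mu> \<and> segment \<Lambda> \<mu> n n = segment \<Lambda> \<mu> m m
        \<longrightarrow> n = 0 \<and> m = dgr \<Lambda> \<mu>)"

definition unicolor :: "('a, 'k::finite) kgraph \<Rightarrow> 'k \<Rightarrow> 'a \<Rightarrow> bool" where
  "unicolor \<Lambda> i \<nu> \<longleftrightarrow> dgr \<Lambda> \<nu> = path_length \<Lambda> \<nu> *s axis i 1"

definition unicolor_cycles :: "('a, 'k::finite) kgraph \<Rightarrow> 'k \<Rightarrow> 'a set" where
  "unicolor_cycles \<Lambda> i = {\<mu>. is_cycle \<Lambda> \<mu> \<and> unicolor \<Lambda> i \<mu>}"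

text \<open>The set \<open>O\<^bsup>\<mu>\<^esup>\<^sub>t\<close> for a cycle \<open>\<mu>\<close> that is unicolor in degree \<open>e\<^sub>i\<close>.\<close>

definition tails :: "('a, 'k::finite) kgraph \<Rightarrow> 'k \<Rightarrow> 'a \<Rightarrow> nat \<Rightarrow> 'a set" where
  "tails \<Lambda> i \<mu> t = {\<nu> \<in> paths \<Lambda>. src \<Lambda> \<nu> = src \<Lambda> \<mu> \<and> unicolor \<Lambda> i \<nu> \<and>
     path_length \<Lambda> \<nu> mod path_length \<Lambda> \<mu> = t mod path_length \<Lambda> \<mu> \<and>
     (dgr \<Lambda> \<mu> \<le> dgr \<Lambda> \<nu> \<longrightarrow>
        (\<forall>n \<le> dgr \<Lambda> \<nu> - dgr \<Lambda> \<mu>. segment \<Lambda> \<nu> n (n + dgr \<Lambda> \<mu>) \<noteq> \<mu>))}"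

text \<open>Since \<open>l\<close> is positive, \<open>card (\<dots>) = l\<close> entails that the set is finite.\<close>

definition HEDL :: "('a, 'k::finite) kgraph \<Rightarrow> bool" where
  "HEDL \<Lambda> \<longleftrightarrow> (\<forall>i. \<forall>\<mu> \<in> unicolor_cycles \<Lambda> i.
     \<exists>l::nat. l > 0 \<and> (\<forall>t < path_length \<Lambda> \<mu>. card (tails \<Lambda> i \<mu> t) = l))"


section \<open>Graded algebras and crossed products\<close>

text \<open>
  The library's \<^locale>\<open>algebra\<close> is restricted to commutative algebras.
\<close>

locale assoc_algebra = Module.module R M + Ring.ring M
  for R (structure) and M (structure) +
  assumes smult_mult_left:
      "\<lbrakk>a \<in> carrier R; x \<in> carrier M; y \<in> carrier M\<rbrakk>
       \<Longrightarrow> (a \<odot>\<^bsub>M\<^esub> x) \<otimes>\<^bsub>M\<^esub> y = a \<odot>\<^bsub>M\<^esub> (x \<otimes>\<^bsub>M\<^esub> y)"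
    and smult_mult_right:
      "\<lbrakk>a \<in> carrier R; x \<in> carrier M; y \<in> carrier M\<rbrakk>
       \<Longrightarrow> x \<otimes>\<^bsub>M\<^esub> (a \<odot>\<^bsub>M\<^esub> y) = a \<odot>\<^bsub>M\<^esub> (x \<otimes>\<^bsub>M\<^esub> y)"

locale graded_algebra = assoc_algebra R M
  for R :: "('r, 'x) ring_scheme" and M :: "('r, 'm, 'y) module_scheme" (structure) +
  fixes G :: "'g::group_add \<Rightarrow> 'm set"
  assumes component_submodule: "submodule (G \<gamma>) R M"
    and component_mult: "\<lbrakk>x \<in> G \<gamma>; y \<in> G \<delta>\<rbrakk> \<Longrightarrow> x \<otimes> y \<in> G (\<gamma> + \<delta>)"
    and direct_sum: "x \<in> carrier M \<Longrightarrow>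
      \<exists>!f. (\<forall>\<gamma>. f \<gamma> \<in> G \<gamma>) \<and> finite {\<gamma>. f \<gamma> \<noteq> \<zero>} \<and> x = (\<Oplus>\<gamma>\<in>{\<gamma>. f \<gamma> \<noteq> \<zero>}. f \<gamma>)"

locale crossed_product = graded_algebra +
  assumes invertible_homogeneous: "\<exists>x \<in> G \<gamma>. x \<in> Units M"

definition lin_span ::
  "('r, 'x) ring_scheme \<Rightarrow> ('r, 'm, 'y) module_scheme \<Rightarrow> 'm set \<Rightarrow> 'm set" where
  "lin_span R M S =
     {\<Oplus>\<^bsub>M\<^esub>x\<in>T. c x \<odot>\<^bsub>M\<^esub> x | c T. finite T \<and> T \<subseteq> S \<and> (\<forall>x\<in>T. c x \<in> carrier R)}"


section \<open>Kumjian--Pask algebras\<close>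

text \<open>
  The free monoid, written additively so that \<open>'x free_word \<Rightarrow>\<^sub>0 'f\<close> is, with the
  library's convolution product, the free unital algebra on the type \<open>'x\<close>.
\<close>

datatype 'x free_word = Word (letters: "'x list")

instantiation free_word :: (type) monoid_add
begin

definition zero_free_word :: "'a free_word" where
  "0 = Word []"

definition plus_free_word :: "'a free_word \<Rightarrow> 'a free_word \<Rightarrow> 'a free_word" where
  "u + v = Word (letters u @ letters v)"

instance
  by standard (simp_all add: zero_free_word_def plus_free_word_def)

end

datatype 'a kp_gen = Vertex 'a | Path 'a | Ghost 'a

definition kp_gens :: "('a, 'k::finite) kgraph \<Rightarrow> 'a kp_gen set" where
  "kp_gens \<Lambda> = Vertex ` vertices \<Lambda> \<union> Path ` (paths \<Lambda> - vertices \<Lambda>)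
     \<union> Ghost ` (paths \<Lambda> - vertices \<Lambda>)"

text \<open>
  The free algebra without unit on the generators: combinations of nonempty words.
  (The unit of the Kumjian--Pask algebra is the sum of the vertices, not the empty word.)
\<close>

definition kp_free :: "('a, 'k::finite) kgraph \<Rightarrow> ('a kp_gen free_word \<Rightarrow>\<^sub>0 'f::field) set" where
  "kp_free \<Lambda> = {x. \<forall>w \<in> Poly_Mapping.keys x. letters w \<noteq> [] \<and> set (letters w) \<subseteq> kp_gens \<Lambda>}"

definition kp_p :: "'a \<Rightarrow> ('a kp_gen free_word \<Rightarrow>\<^sub>0 'f::field)" where
  "kp_p v = Poly_Mapping.single (Word [Vertex v]) 1"

definition kp_s :: "('a, 'k::finite) kgraph \<Rightarrow> 'a \<Rightarrow> ('a kp_gen free_word \<Rightarrow>\<^sub>0 'f::field)" where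
  "kp_s \<Lambda> \<nu> = (if \<nu> \<in> vertices \<Lambda> then kp_p \<nu> else Poly_Mapping.single (Word [Path \<nu>]) 1)"

definition kp_s_star :: "('a, 'k::finite) kgraph \<Rightarrow> 'a \<Rightarrow> ('a kp_gen free_word \<Rightarrow>\<^sub>0 'f::field)" where
  "kp_s_star \<Lambda> \<nu> =
     (if \<nu> \<in> vertices \<Lambda> then kp_p \<nu> else Poly_Mapping.single (Word [Ghost \<nu>]) 1)"

text \<open>A relation \<open>x = y\<close> is represented by the element \<open>x - y\<close>.\<close>

inductive_set kp_relations ::
  "('a, 'k::finite) kgraph \<Rightarrow> ('a kp_gen free_word \<Rightarrow>\<^sub>0 'f::field) set"
  for \<Lambda> :: "('a, 'k) kgraph" where
  KP1: "\<lbrakk>u \<in> vertices \<Lambda>; v \<in> vertices \<Lambda>\<rbrakk>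
    \<Longrightarrow> kp_p u * kp_p v - (if u = v then kp_p u else 0) \<in> kp_relations \<Lambda>"
| KP2_path: "\<lbrakk>\<nu> \<in> paths \<Lambda> - vertices \<Lambda>; \<mu> \<in> paths \<Lambda> - vertices \<Lambda>; src \<Lambda> \<nu> = rng \<Lambda> \<mu>\<rbrakk>
    \<Longrightarrow> kp_s \<Lambda> \<nu> * kp_s \<Lambda> \<mu> - kp_s \<Lambda> (cmp \<Lambda> \<nu> \<mu>) \<in> kp_relations \<Lambda>"
| KP2_ghost: "\<lbrakk>\<nu> \<in> paths \<Lambda> - vertices \<Lambda>; \<mu> \<in> paths \<Lambda> - vertices \<Lambda>; src \<Lambda> \<nu> = rng \<Lambda> \<mu>\<rbrakk>
    \<Longrightarrow> kp_s_star \<Lambda> \<mu> * kp_s_star \<Lambda> \<nu> - kp_s_star \<Lambda> (cmp \<Lambda> \<nu> \<mu>) \<in> kp_relations \<Lambda>"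
| KP2_path_rng: "\<nu> \<in> paths \<Lambda> - vertices \<Lambda>
    \<Longrightarrow> kp_p (rng \<Lambda> \<nu>) * kp_s \<Lambda> \<nu> - kp_s \<Lambda> \<nu> \<in> kp_relations \<Lambda>"
| KP2_path_src: "\<nu> \<in> paths \<Lambda> - vertices \<Lambda>
    \<Longrightarrow> kp_s \<Lambda> \<nu> * kp_p (src \<Lambda> \<nu>) - kp_s \<Lambda> \<nu> \<in> kp_relations \<Lambda>"
| KP2_ghost_src: "\<nu> \<in> paths \<Lambda> - vertices \<Lambda>
    \<Longrightarrow> kp_p (src \<Lambda> \<nu>) * kp_s_star \<Lambda> \<nu> - kp_s_star \<Lambda> \<nu> \<in> kp_relations \<Lambda>"
| KP2_ghost_rng: "\<nu> \<in> paths \<Lambda> - vertices \<Lambda>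
    \<Longrightarrow> kp_s_star \<Lambda> \<nu> * kp_p (rng \<Lambda> \<nu>) - kp_s_star \<Lambda> \<nu> \<in> kp_relations \<Lambda>"
| KP3: "\<lbrakk>\<nu> \<in> paths \<Lambda> - vertices \<Lambda>; \<mu> \<in> paths \<Lambda> - vertices \<Lambda>; dgr \<Lambda> \<nu> = dgr \<Lambda> \<mu>\<rbrakk>
    \<Longrightarrow> kp_s_star \<Lambda> \<nu> * kp_s \<Lambda> \<mu> - (if \<nu> = \<mu> then kp_p (src \<Lambda> \<nu>) else 0) \<in> kp_relations \<Lambda>"
| KP4: "\<lbrakk>v \<in> vertices \<Lambda>; n \<noteq> 0\<rbrakk>
    \<Longrightarrow> kp_p v - (\<Sum>\<nu> \<in> paths_from \<Lambda> v n. kp_s \<Lambda> \<nu> * kp_s_star \<Lambda> \<nu>) \<in> kp_relations \<Lambda>"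

text \<open>
  The two-sided algebra ideal generated by the relations. Multiplication by
  \<open>Poly_Mapping.single 0 c\<close> is scalar multiplication by \<open>c\<close>.
\<close>

inductive_set kp_ideal ::
  "('a, 'k::finite) kgraph \<Rightarrow> ('a kp_gen free_word \<Rightarrow>\<^sub>0 'f::field) set"
  for \<Lambda> :: "('a, 'k) kgraph" where
  zero: "0 \<in> kp_ideal \<Lambda>"
| relation: "x \<in> kp_relations \<Lambda> \<Longrightarrow> x \<in> kp_ideal \<Lambda>"
| add: "\<lbrakk>x \<in> kp_ideal \<Lambda>; y \<in> kp_ideal \<Lambda>\<rbrakk> \<Longrightarrow> x + y \<in> kp_ideal \<Lambda>"
| scale: "x \<in> kp_ideal \<Lambda> \<Longrightarrow> Poly_Mapping.single 0 c * x \<in> kp_ideal \<Lambda>"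
| mult_left: "\<lbrakk>a \<in> kp_free \<Lambda>; x \<in> kp_ideal \<Lambda>\<rbrakk> \<Longrightarrow> a * x \<in> kp_ideal \<Lambda>"
| mult_right: "\<lbrakk>x \<in> kp_ideal \<Lambda>; a \<in> kp_free \<Lambda>\<rbrakk> \<Longrightarrow> x * a \<in> kp_ideal \<Lambda>"

text \<open>
  The field \<open>one\<close> of this record is not a unit of the free algebra; it is the representative
  of the unit of the quotient when there are finitely many vertices (and junk otherwise).
\<close>

definition kp_free_ring :: "('a, 'k::finite) kgraph \<Rightarrow> ('a kp_gen free_word \<Rightarrow>\<^sub>0 'f::field) ring" where
  "kp_free_ring \<Lambda> = \<lparr>carrier = kp_free \<Lambda>, monoid.mult = (*), one = (\<Sum>v \<in> vertices \<Lambda>. kp_p v),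
     zero = 0, add = (+)\<rparr>"

definition kp_class ::
  "('a, 'k::finite) kgraph \<Rightarrow> ('a kp_gen free_word \<Rightarrow>\<^sub>0 'f::field)
   \<Rightarrow> ('a kp_gen free_word \<Rightarrow>\<^sub>0 'f) set" where
  "kp_class \<Lambda> x = kp_ideal \<Lambda> +>\<^bsub>kp_free_ring \<Lambda>\<^esub> x"

definition kumjian_pask ::
  "('a, 'k::finite) kgraph \<Rightarrow> ('f::field, ('a kp_gen free_word \<Rightarrow>\<^sub>0 'f) set) module" where
  "kumjian_pask \<Lambda> =
     (let Q = kp_free_ring \<Lambda> Quot kp_ideal \<Lambda>
      in \<lparr>carrier = carrier Q, monoid.mult = monoid.mult Q, one = one Q, zero = zero Q, add = add Q,
          module.smult = (\<lambda>c B. \<Union>x\<in>B. kp_class \<Lambda> (Poly_Mapping.single 0 c * x))\<rparr>)"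

definition int_dgr :: "('a, 'k::finite) kgraph \<Rightarrow> 'a \<Rightarrow> int ^ 'k" where
  "int_dgr \<Lambda> \<nu> = (\<chi> i. int (dgr \<Lambda> \<nu> $ i))"

text \<open>
  \<^const>\<open>ring_of_type_algebra\<close> is the field \<^typ>\<open>'f\<close>, as a record.
\<close>

definition kp_component ::
  "('a, 'k::finite) kgraph \<Rightarrow> int ^ 'k \<Rightarrow> ('a kp_gen free_word \<Rightarrow>\<^sub>0 'f::field) set set" where
  "kp_component \<Lambda> n = lin_span (ring_of_type_algebra :: 'f ring) (kumjian_pask \<Lambda>)
     {kp_class \<Lambda> (kp_s \<Lambda> \<nu>) \<otimes>\<^bsub>kumjian_pask \<Lambda>\<^esub> kp_class \<Lambda> (kp_s_star \<Lambda> \<mu>) | \<nu> \<mu>.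
        \<nu> \<in> paths \<Lambda> \<and> \<mu> \<in> paths \<Lambda> \<and> int_dgr \<Lambda> \<nu> - int_dgr \<Lambda> \<mu> = n}"

end

theory Submission
  imports Defs
begin

text \<open>
  If \<open>\<sigma>\<close> is a source-preserving bijection from the paths of degree \<open>m\<close> onto the paths of degree
  \<open>n\<close>, then, by KP3 and KP4, \<open>\<Sum> s\<^bsub>\<nu>\<^esub> s\<^bsub>\<sigma>(\<nu>)*\<^esub>\<close> is invertible with inverse \<open>\<Sum> s\<^bsub>\<sigma>(\<nu>)\<^esub> s\<^bsub>\<nu>*\<^esub>\<close>; it is
  homogeneous of degree \<open>m - n\<close>. Hence it suffices to find such a bijection for
  \<open>m = (N + 1) e\<^sub>i\<close> and \<open>n = N e\<^sub>i\<close>, that is, to see that the number of paths of degree \<open>N e\<^sub>i\<close> with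
  source \<open>w\<close> does not depend on \<open>N\<close> for large \<open>N\<close>. If there are arbitrarily long such paths, then by
  HNE the vertex \<open>w\<close> lies on a cycle \<open>\<mu>\<close> of colour \<open>i\<close>, and each of these paths is uniquely an
  element of \<open>O\<^bsup>\<mu>\<^esup>\<^sub>t\<close>, where \<open>t = N mod |\<mu>|\<close>, followed by a power of \<open>\<mu>\<close>. By HEDL their number is
  eventually \<open>l\<^bsup>\<mu>\<^esup>\<close>.
\<close>

section \<open>Counting paths of one colour\<close>

text \<open>The degrees that carry a homogeneous unit are closed under addition, and the element
  built from \<sigma> has its inverse in the opposite degree; so the unit vectors give all of Z^k.
  Only large \<open>N\<close> will do: for small \<open>N\<close> some tails are too long to occur,
  and the counts may differ. One \<open>N\<close> serves all sources because there are finitely many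
  vertices. HNE leaves a single way to continue from a loop within its colour: a path that repeats a
  vertex follows the loop from then on, which puts its end on the loop and lets any occurrence of
  \<mu> slide to the end of the path.

  A crossed product is in particular graded, so directness of the sum has to come out of the
  presentation. The free algebra is graded by degrees of words; the relations are homogeneous, hence
  so is the ideal. It remains to match the images of words with the prescribed spanning products.
  The algebra is a quotient of an algebra without unit, so its unit law has to be derived as
  well.\<close>

lemma axis_add: "axis i (a + b) = axis i a + axis i b" for a b :: "'b::monoid_add"
  by (simp add: vec_eq_iff axis_def)

lemma axis_le_axis_iff: "axis i a \<le> axis i b \<longleftrightarrow> a \<le> b" for a b :: nat
  by (auto simp: less_eq_vec_def axis_def)

lemma le_axisE:
  fixes n :: "nat ^ 'k::finite"
  assumes "n \<le> axis i b"
  obtains a where "n = axis i a" "a \<le> b"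
proof
  show "n = axis i (n $ i)"
    using assms by (auto simp: vec_eq_iff less_eq_vec_def axis_def dest: spec split: if_splits)
  show "n $ i \<le> b"
    using assms by (auto simp: less_eq_vec_def axis_def dest: spec[of _ i])
qed

lemma axis_smult_1: "n *s axis i 1 = axis i n" for n :: nat
  by (simp add: vec_eq_iff axis_def)

lemma sum_axis: "(\<Sum>j\<in>UNIV. axis i n $ j) = n" for n :: nat
  by (simp add: axis_def)

lemma unicolor_iff: "unicolor \<Lambda> i \<nu> \<longleftrightarrow> (\<exists>n. dgr \<Lambda> \<nu> = axis i n)"
  unfolding unicolor_def path_length_def axis_smult_1
  by (metis sum_axis)

lemma path_length_axis: "dgr \<Lambda> \<nu> = axis i n \<Longrightarrow> path_length \<Lambda> \<nu> = n"
  by (simp add: path_length_def sum_axis)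

context k_graph
begin

section \<open>Cancellation, factorization and segments\<close>

text \<open>Additivity of the degree makes the second factors agree in degree as well, so both pairs
  factor one path in the same two degrees and \<open>unique_factorization\<close> identifies
  them.\<close>

lemma cmp_cancel:
  assumes "\<alpha> \<in> paths \<Lambda>" "\<beta> \<in> paths \<Lambda>" "src \<Lambda> \<alpha> = rng \<Lambda> \<beta>"
    and "\<alpha>' \<in> paths \<Lambda>" "\<beta>' \<in> paths \<Lambda>" "src \<Lambda> \<alpha>' = rng \<Lambda> \<beta>'"
    and "cmp \<Lambda> \<alpha> \<beta> = cmp \<Lambda> \<alpha>' \<beta>'" "dgr \<Lambda> \<alpha> = dgr \<Lambda> \<alpha>'"
  shows "\<alpha> = \<alpha>'" "\<beta> = \<beta>'"
proof -
  have d: "dgr \<Lambda> (cmp \<Lambda> \<alpha> \<beta>) = dgr \<Lambda> \<alpha> + dgr \<Lambda> \<beta>"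
    and "dgr \<Lambda> (cmp \<Lambda> \<alpha>' \<beta>') = dgr \<Lambda> \<alpha>' + dgr \<Lambda> \<beta>'"
    by (rule dgr_cmp[OF assms(1-3)], rule dgr_cmp[OF assms(4-6)])
  then have "dgr \<Lambda> \<alpha> + dgr \<Lambda> \<beta> = dgr \<Lambda> \<alpha> + dgr \<Lambda> \<beta>'"
    using assms(7,8) by metis
  then have "dgr \<Lambda> \<beta> = dgr \<Lambda> \<beta>'"
    by simp
  note \<beta> = this
  obtain p where p: "\<And>q. fst q \<in> paths \<Lambda> \<and> snd q \<in> paths \<Lambda> \<and> src \<Lambda> (fst q) = rng \<Lambda> (snd q) \<and>
      dgr \<Lambda> (fst q) = dgr \<Lambda> \<alpha> \<and> dgr \<Lambda> (snd q) = dgr \<Lambda> \<beta> \<and>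
      cmp \<Lambda> \<alpha> \<beta> = cmp \<Lambda> (fst q) (snd q) \<Longrightarrow> q = p"
    using unique_factorization[OF cmp_closed[OF assms(1-3)] d] by (elim ex1E) blast
  have "(\<alpha>, \<beta>) = p"
    by (rule p) (use assms in simp)
  also have "p = (\<alpha>', \<beta>')"
    by (rule p[symmetric]) (use assms \<beta> in simp)
  finally show "\<alpha> = \<alpha>'" "\<beta> = \<beta>'" by auto
qed

lemma cmp_cancel_right:
  assumes "\<alpha> \<in> paths \<Lambda>" "\<beta> \<in> paths \<Lambda>" "src \<Lambda> \<alpha> = rng \<Lambda> \<beta>"
    and "\<alpha>' \<in> paths \<Lambda>" "src \<Lambda> \<alpha>' = rng \<Lambda> \<beta>"
    and "cmp \<Lambda> \<alpha> \<beta> = cmp \<Lambda> \<alpha>' \<beta>"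
  shows "\<alpha> = \<alpha>'"
proof -
  have "dgr \<Lambda> \<alpha> + dgr \<Lambda> \<beta> = dgr \<Lambda> \<alpha>' + dgr \<Lambda> \<beta>"
    using assms dgr_cmp by metis
  then show ?thesis
    using assms by (intro cmp_cancel(1)[of \<alpha> \<beta> \<alpha>' \<beta>]) auto
qed

lemma factorE:
  assumes "\<nu> \<in> paths \<Lambda>" "dgr \<Lambda> \<nu> = n + m"
  obtains \<alpha> \<beta> where "\<alpha> \<in> paths \<Lambda>" "\<beta> \<in> paths \<Lambda>" "src \<Lambda> \<alpha> = rng \<Lambda> \<beta>"
    "dgr \<Lambda> \<alpha> = n" "dgr \<Lambda> \<beta> = m" "\<nu> = cmp \<Lambda> \<alpha> \<beta>" "rng \<Lambda> \<alpha> = rng \<Lambda> \<nu>" "src \<Lambda> \<beta> = src \<Lambda> \<nu>"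
proof -
  obtain p where "fst p \<in> paths \<Lambda>" "snd p \<in> paths \<Lambda>" "src \<Lambda> (fst p) = rng \<Lambda> (snd p)"
    "dgr \<Lambda> (fst p) = n" "dgr \<Lambda> (snd p) = m" "\<nu> = cmp \<Lambda> (fst p) (snd p)"
    using unique_factorization[OF assms] by (elim ex1E) blast
  then show thesis
    using that[of "fst p" "snd p"] by (simp add: rng_cmp src_cmp)
qed

text \<open>\<open>rng \<Lambda> v\<close> followed by \<open>v\<close>, and \<open>v\<close>
  followed by \<open>src \<Lambda> v\<close>, are two factorizations of \<open>v\<close> in degrees
  0 and 0.\<close>

lemma vertex_rng_src:
  assumes "v \<in> vertices \<Lambda>"
  shows "rng \<Lambda> v = v" "src \<Lambda> v = v"
proof -
  have v: "v \<in> paths \<Lambda>" "dgr \<Lambda> v = 0"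
    using assms by (auto simp: vertices_def)
  show "rng \<Lambda> v = v"
    using cmp_cancel(1)[of "rng \<Lambda> v" v v "src \<Lambda> v"] v
    by (simp add: rng_closed src_closed src_rng rng_src cmp_rng cmp_src dgr_rng)
  then show "src \<Lambda> v = v"
    using src_rng[OF v(1)] by simp
qed

lemma rng_in_vertices: "\<nu> \<in> paths \<Lambda> \<Longrightarrow> rng \<Lambda> \<nu> \<in> vertices \<Lambda>"
  by (simp add: vertices_def rng_closed dgr_rng)

lemma src_in_vertices: "\<nu> \<in> paths \<Lambda> \<Longrightarrow> src \<Lambda> \<nu> \<in> vertices \<Lambda>"
  by (simp add: vertices_def src_closed dgr_src)

text \<open>This evaluates the definite description: any factorization with the right degrees
  exhibits the segment. Comparing the initial pieces of degree \<open>m\<close>, and then what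
  follows \<open>\<alpha>\<close> in them, shows that the middle piece is determined.\<close>

lemma segment_eq:
  assumes "\<alpha> \<in> paths \<Lambda>" "\<beta> \<in> paths \<Lambda>" "\<gamma> \<in> paths \<Lambda>" "src \<Lambda> \<alpha> = rng \<Lambda> \<beta>" "src \<Lambda> \<beta> = rng \<Lambda> \<gamma>"
    and "dgr \<Lambda> \<alpha> = n" "dgr \<Lambda> \<alpha> + dgr \<Lambda> \<beta> = m"
  shows "segment \<Lambda> (cmp \<Lambda> (cmp \<Lambda> \<alpha> \<beta>) \<gamma>) n m = \<beta>"
  unfolding segment_def
proof (rule the_equality)
  have mn: "m - n = dgr \<Lambda> \<beta>" "dgr \<Lambda> (cmp \<Lambda> (cmp \<Lambda> \<alpha> \<beta>) \<gamma>) - m = dgr \<Lambda> \<gamma>"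
    using assms(1-5) unfolding assms(6,7)[symmetric]
    by (simp_all add: dgr_cmp cmp_closed src_cmp vec_eq_iff)
  show "\<beta> \<in> paths \<Lambda> \<and> dgr \<Lambda> \<beta> = m - n \<and>
     (\<exists>\<alpha>'\<in>paths \<Lambda>. \<exists>\<gamma>'\<in>paths \<Lambda>. src \<Lambda> \<alpha>' = rng \<Lambda> \<beta> \<and> src \<Lambda> \<beta> = rng \<Lambda> \<gamma>' \<and> dgr \<Lambda> \<alpha>' = n \<and>
       dgr \<Lambda> \<gamma>' = dgr \<Lambda> (cmp \<Lambda> (cmp \<Lambda> \<alpha> \<beta>) \<gamma>) - m \<and>
       cmp \<Lambda> (cmp \<Lambda> \<alpha> \<beta>) \<gamma> = cmp \<Lambda> (cmp \<Lambda> \<alpha>' \<beta>) \<gamma>')"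
    by (intro conjI, fact, simp add: mn, rule bexI[of _ \<alpha>], rule bexI[of _ \<gamma>])
      (use assms mn in simp_all)
  fix \<beta>' assume "\<beta>' \<in> paths \<Lambda> \<and> dgr \<Lambda> \<beta>' = m - n \<and>
     (\<exists>\<alpha>'\<in>paths \<Lambda>. \<exists>\<gamma>'\<in>paths \<Lambda>. src \<Lambda> \<alpha>' = rng \<Lambda> \<beta>' \<and> src \<Lambda> \<beta>' = rng \<Lambda> \<gamma>' \<and> dgr \<Lambda> \<alpha>' = n \<and>
       dgr \<Lambda> \<gamma>' = dgr \<Lambda> (cmp \<Lambda> (cmp \<Lambda> \<alpha> \<beta>) \<gamma>) - m \<and>
       cmp \<Lambda> (cmp \<Lambda> \<alpha> \<beta>) \<gamma> = cmp \<Lambda> (cmp \<Lambda> \<alpha>' \<beta>') \<gamma>')"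
  then obtain \<alpha>' \<gamma>' where *: "\<beta>' \<in> paths \<Lambda>" "dgr \<Lambda> \<beta>' = dgr \<Lambda> \<beta>" "\<alpha>' \<in> paths \<Lambda>" "\<gamma>' \<in> paths \<Lambda>"
    "src \<Lambda> \<alpha>' = rng \<Lambda> \<beta>'" "src \<Lambda> \<beta>' = rng \<Lambda> \<gamma>'" "dgr \<Lambda> \<alpha>' = n"
    "cmp \<Lambda> (cmp \<Lambda> \<alpha> \<beta>) \<gamma> = cmp \<Lambda> (cmp \<Lambda> \<alpha>' \<beta>') \<gamma>'"
    using mn by auto
  have "cmp \<Lambda> \<alpha> \<beta> = cmp \<Lambda> \<alpha>' \<beta>'"
    by (rule cmp_cancel(1)[OF _ _ _ _ _ _ *(8)])
      (use assms *(1-7) in \<open>simp_all add: cmp_closed dgr_cmp src_cmp\<close>)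
  from cmp_cancel(2)[OF assms(1,2,4) *(3,1,5) this] show "\<beta>' = \<beta>"
    using assms(6) *(7) by simp
qed

text \<open>The vertex is a middle piece of degree 0, the identity inserted between
  \<open>\<alpha>\<close> and \<open>\<beta>\<close>.\<close>

lemma segment_vertex:
  assumes "\<alpha> \<in> paths \<Lambda>" "\<beta> \<in> paths \<Lambda>" "src \<Lambda> \<alpha> = rng \<Lambda> \<beta>" "dgr \<Lambda> \<alpha> = n"
  shows "segment \<Lambda> (cmp \<Lambda> \<alpha> \<beta>) n n = rng \<Lambda> \<beta>"
  using segment_eq[of \<alpha> "rng \<Lambda> \<beta>" \<beta> n n] assms
  by (metis add.right_neutral cmp_src dgr_rng rng_closed rng_rng src_rng)

lemma segmentE:
  assumes "\<nu> \<in> paths \<Lambda>" "dgr \<Lambda> \<nu> = n + m + l"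
  obtains \<alpha> \<beta> \<gamma> where "\<alpha> \<in> paths \<Lambda>" "\<beta> \<in> paths \<Lambda>" "\<gamma> \<in> paths \<Lambda>"
    "src \<Lambda> \<alpha> = rng \<Lambda> \<beta>" "src \<Lambda> \<beta> = rng \<Lambda> \<gamma>" "dgr \<Lambda> \<alpha> = n" "dgr \<Lambda> \<beta> = m" "dgr \<Lambda> \<gamma> = l"
    "\<nu> = cmp \<Lambda> (cmp \<Lambda> \<alpha> \<beta>) \<gamma>" "segment \<Lambda> \<nu> n (n + m) = \<beta>" "rng \<Lambda> \<alpha> = rng \<Lambda> \<nu>" "src \<Lambda> \<gamma> = src \<Lambda> \<nu>"
proof -
  obtain \<delta> \<gamma> where 1: "\<delta> \<in> paths \<Lambda>" "\<gamma> \<in> paths \<Lambda>" "src \<Lambda> \<delta> = rng \<Lambda> \<gamma>"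
    "dgr \<Lambda> \<delta> = n + m" "dgr \<Lambda> \<gamma> = l" "\<nu> = cmp \<Lambda> \<delta> \<gamma>" "rng \<Lambda> \<delta> = rng \<Lambda> \<nu>" "src \<Lambda> \<gamma> = src \<Lambda> \<nu>"
    using factorE[OF assms] by metis
  obtain \<alpha> \<beta> where 2: "\<alpha> \<in> paths \<Lambda>" "\<beta> \<in> paths \<Lambda>" "src \<Lambda> \<alpha> = rng \<Lambda> \<beta>"
    "dgr \<Lambda> \<alpha> = n" "dgr \<Lambda> \<beta> = m" "\<delta> = cmp \<Lambda> \<alpha> \<beta>" "rng \<Lambda> \<alpha> = rng \<Lambda> \<delta>" "src \<Lambda> \<beta> = src \<Lambda> \<delta>"
    using factorE[OF 1(1,4)] by metis
  show thesis
    using that[of \<alpha> \<beta> \<gamma>] 1 2 segment_eq[of \<alpha> \<beta> \<gamma> n "n + m"] by simp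
qed

section \<open>Loops without entrances\<close>

text \<open>By HNE a path from the base point that is no longer than \<open>\<kappa>\<close> is an
  initial piece of \<open>\<kappa>\<close>. A longer one begins with \<open>\<kappa>\<close> itself;
  stripping it off shortens the path because \<open>m > 0\<close>, and the induction
  applies.\<close>

lemma paths_from_loop_unique:
  assumes HNE: "HNE \<Lambda>" and loop: "is_loop \<Lambda> \<kappa>" and d: "dgr \<Lambda> \<kappa> = axis i m" and m: "m > 0"
    and "\<nu> \<in> paths \<Lambda>" "rng \<Lambda> \<nu> = src \<Lambda> \<kappa>" "dgr \<Lambda> \<nu> = axis i n"
    and "\<nu>' \<in> paths \<Lambda>" "rng \<Lambda> \<nu>' = src \<Lambda> \<kappa>" "dgr \<Lambda> \<nu>' = axis i n"
  shows "\<nu> = \<nu>'"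
  using assms(5-)
proof (induction n arbitrary: \<nu> \<nu>' rule: less_induct)
  case (less n)
  \<comment> \<open>The right-hand side depends on \<open>a\<close> alone, so two short paths of
    equal length agree by way of it.\<close>
  have short: "\<rho> = segment \<Lambda> \<kappa> 0 (axis i a)"
    if "a \<le> m" "\<rho> \<in> paths \<Lambda>" "rng \<Lambda> \<rho> = src \<Lambda> \<kappa>" "dgr \<Lambda> \<rho> = axis i a" for a \<rho>
    using HNE loop that d unfolding HNE_def is_entrance_def by (metis axis_le_axis_iff)
  show ?case
  proof (cases "n \<le> m")
    case True
    then show ?thesis using short less.prems by metis
  next
    case False
    then have n: "axis i n = axis i m + axis i (n - m)"
      by (simp flip: axis_add)
    obtain \<alpha> \<beta> where 1: "\<alpha> \<in> paths \<Lambda>" "\<beta> \<in> paths \<Lambda>" "src \<Lambda> \<alpha> = rng \<Lambda> \<beta>"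
      "dgr \<Lambda> \<alpha> = axis i m" "dgr \<Lambda> \<beta> = axis i (n - m)" "\<nu> = cmp \<Lambda> \<alpha> \<beta>" "rng \<Lambda> \<alpha> = rng \<Lambda> \<nu>"
      using factorE less.prems(1,3) n by metis
    obtain \<alpha>' \<beta>' where 2: "\<alpha>' \<in> paths \<Lambda>" "\<beta>' \<in> paths \<Lambda>" "src \<Lambda> \<alpha>' = rng \<Lambda> \<beta>'"
      "dgr \<Lambda> \<alpha>' = axis i m" "dgr \<Lambda> \<beta>' = axis i (n - m)" "\<nu>' = cmp \<Lambda> \<alpha>' \<beta>'" "rng \<Lambda> \<alpha>' = rng \<Lambda> \<nu>'"
      using factorE less.prems(4,6) n by metis
    have "\<kappa> \<in> paths \<Lambda>" "rng \<Lambda> \<kappa> = src \<Lambda> \<kappa>"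
      using loop by (auto simp: is_loop_def)
    then have "\<alpha> = \<kappa>" "\<alpha>' = \<kappa>"
      using short[of m] 1 2 less.prems d by (metis order_refl)+
    then have "\<beta> = \<beta>'"
      using less.IH[of "n - m"] 1 2 False m by auto
    with \<open>\<alpha> = \<kappa>\<close> \<open>\<alpha>' = \<kappa>\<close> show ?thesis
      using 1 2 by simp
  qed
qed

text \<open>The path is forced to run around \<open>\<kappa>\<close>. Once full turns are stripped
  off, \<open>\<rho>\<close> is an initial piece of \<open>\<kappa>\<close>, and the loop can be
  started at the end of that piece instead.\<close>

lemma loop_return:
  assumes HNE: "HNE \<Lambda>" and loop: "is_loop \<Lambda> \<kappa>" and d: "dgr \<Lambda> \<kappa> = axis i m" and m: "m > 0"
    and "\<rho> \<in> paths \<Lambda>" "rng \<Lambda> \<rho> = src \<Lambda> \<kappa>" "dgr \<Lambda> \<rho> = axis i n"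
  shows "\<exists>\<mu>. is_loop \<Lambda> \<mu> \<and> src \<Lambda> \<mu> = src \<Lambda> \<rho> \<and> dgr \<Lambda> \<mu> = axis i m"
  using assms(5-)
proof (induction n arbitrary: \<rho> rule: less_induct)
  case (less n)
  have \<kappa>: "\<kappa> \<in> paths \<Lambda>" "rng \<Lambda> \<kappa> = src \<Lambda> \<kappa>"
    using loop by (auto simp: is_loop_def)
  show ?case
  proof (cases "n \<le> m")
    case True
    then have "dgr \<Lambda> \<kappa> = axis i n + axis i (m - n)"
      by (simp add: d flip: axis_add)
    then obtain \<alpha> \<beta> where 1: "\<alpha> \<in> paths \<Lambda>" "\<beta> \<in> paths \<Lambda>" "src \<Lambda> \<alpha> = rng \<Lambda> \<beta>"
      "dgr \<Lambda> \<alpha> = axis i n" "dgr \<Lambda> \<beta> = axis i (m - n)" "\<kappa> = cmp \<Lambda> \<alpha> \<beta>"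
      "rng \<Lambda> \<alpha> = rng \<Lambda> \<kappa>" "src \<Lambda> \<beta> = src \<Lambda> \<kappa>"
      using factorE[OF \<kappa>(1)] by metis
    have "\<alpha> = \<rho>"
      using paths_from_loop_unique[OF HNE loop d m, of \<alpha> n \<rho>] 1 less.prems \<kappa> by simp
    \<comment> \<open>As \<open>\<kappa>\<close> is \<open>\<rho>\<close> followed by
      \<open>\<beta>\<close>, the rotated loop is \<open>\<beta>\<close> followed by
      \<open>\<rho>\<close>.\<close>
    then have "is_loop \<Lambda> (cmp \<Lambda> \<beta> \<rho>) \<and> src \<Lambda> (cmp \<Lambda> \<beta> \<rho>) = src \<Lambda> \<rho> \<and> dgr \<Lambda> (cmp \<Lambda> \<beta> \<rho>) = axis i m"
      using 1(1-5,8) less.prems True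
      by (simp add: is_loop_def cmp_closed rng_cmp src_cmp dgr_cmp flip: axis_add)
    then show ?thesis ..
  next
    case False
    then have "axis i n = axis i m + axis i (n - m)"
      by (simp flip: axis_add)
    then obtain \<alpha> \<beta> where 1: "\<alpha> \<in> paths \<Lambda>" "\<beta> \<in> paths \<Lambda>" "src \<Lambda> \<alpha> = rng \<Lambda> \<beta>"
      "dgr \<Lambda> \<alpha> = axis i m" "dgr \<Lambda> \<beta> = axis i (n - m)" "\<rho> = cmp \<Lambda> \<alpha> \<beta>"
      "rng \<Lambda> \<alpha> = rng \<Lambda> \<rho>" "src \<Lambda> \<beta> = src \<Lambda> \<rho>"
      using factorE less.prems(1,3) by metis
    have "\<alpha> = \<kappa>"
      using paths_from_loop_unique[OF HNE loop d m, of \<alpha> m \<kappa>] 1(1,4,7) less.prems \<kappa> d by simp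
    then show ?thesis
      using less.IH[of "n - m" \<beta>] 1(1-5,8) False m by auto
  qed
qed

text \<open>The source is fixed because \<sigma> has to preserve it: the bijection is chosen
  separately for each \<open>w\<close>.\<close>

definition axis_paths_to :: "'k \<Rightarrow> nat \<Rightarrow> 'a \<Rightarrow> 'a set" where
  "axis_paths_to i n w = {\<nu> \<in> paths \<Lambda>. dgr \<Lambda> \<nu> = axis i n \<and> src \<Lambda> \<nu> = w}"

text \<open>A path of length \<open>n\<close> meets \<open>n + 1\<close> vertices counted with
  repetition, so it repeats one as soon as \<open>n\<close> is at least the number of vertices. The
  repetition cuts out a loop \<open>\<beta>\<close>, and \<open>loop_return\<close> carries it along
  the rest \<open>\<gamma>\<close> to the endpoint \<open>w\<close>.\<close>

lemma loop_if_long_path: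
  assumes HNE: "HNE \<Lambda>" and fin: "finite (vertices \<Lambda>)"
    and \<nu>: "\<nu> \<in> axis_paths_to i n w" and n: "n \<ge> card (vertices \<Lambda>)"
  shows "\<exists>\<mu> m. is_loop \<Lambda> \<mu> \<and> src \<Lambda> \<mu> = w \<and> dgr \<Lambda> \<mu> = axis i m \<and> m > 0"
proof -
  have \<nu>: "\<nu> \<in> paths \<Lambda>" "dgr \<Lambda> \<nu> = axis i n" "src \<Lambda> \<nu> = w"
    using \<nu> by (auto simp: axis_paths_to_def)
  define f where "f j = segment \<Lambda> \<nu> (axis i j) (axis i j)" for j
  have "f ` {..n} \<subseteq> vertices \<Lambda>"
  proof clarify
    fix j assume "j \<le> n"
    then have "dgr \<Lambda> \<nu> = axis i j + axis i (n - j)"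
      using \<nu> by (simp flip: axis_add)
    then obtain \<alpha> \<beta> where "\<alpha> \<in> paths \<Lambda>" "\<beta> \<in> paths \<Lambda>" "src \<Lambda> \<alpha> = rng \<Lambda> \<beta>" "dgr \<Lambda> \<alpha> = axis i j"
      "\<nu> = cmp \<Lambda> \<alpha> \<beta>"
      using factorE[OF \<nu>(1)] by metis
    then show "f j \<in> vertices \<Lambda>"
      using segment_vertex[of \<alpha> \<beta>] by (simp add: f_def rng_in_vertices)
  qed
  then have "card (f ` {..n}) \<le> card (vertices \<Lambda>)"
    by (rule card_mono[OF fin])
  then have "\<not> inj_on f {..n}"
    using n by (intro pigeonhole) simp
  then obtain a b where ab: "a < b" "b \<le> n" "f a = f b"
    unfolding inj_on_def by (metis atMost_iff linorder_neqE_nat)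
  have "dgr \<Lambda> \<nu> = axis i a + axis i (b - a) + axis i (n - b)"
    using ab \<nu> by (simp flip: axis_add)
  then obtain \<alpha> \<beta> \<gamma> where s: "\<alpha> \<in> paths \<Lambda>" "\<beta> \<in> paths \<Lambda>" "\<gamma> \<in> paths \<Lambda>"
    "src \<Lambda> \<alpha> = rng \<Lambda> \<beta>" "src \<Lambda> \<beta> = rng \<Lambda> \<gamma>" "dgr \<Lambda> \<alpha> = axis i a" "dgr \<Lambda> \<beta> = axis i (b - a)"
    "dgr \<Lambda> \<gamma> = axis i (n - b)" "\<nu> = cmp \<Lambda> (cmp \<Lambda> \<alpha> \<beta>) \<gamma>" "src \<Lambda> \<gamma> = src \<Lambda> \<nu>"
    using segmentE[OF \<nu>(1)] by metis
  have "f b = rng \<Lambda> \<gamma>"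
    using segment_vertex[of "cmp \<Lambda> \<alpha> \<beta>" \<gamma> "axis i b"] s(1-9) ab
    by (simp add: f_def cmp_closed src_cmp dgr_cmp flip: axis_add)
  moreover have "f a = rng \<Lambda> \<beta>"
    using segment_vertex[of \<alpha> "cmp \<Lambda> \<beta> \<gamma>" "axis i a"] s(1-9)
    by (simp add: f_def cmp_closed rng_cmp cmp_assoc)
  ultimately have "is_loop \<Lambda> \<beta>"
    using s(2,5) ab by (simp add: is_loop_def)
  then obtain \<mu> where "is_loop \<Lambda> \<mu>" "src \<Lambda> \<mu> = src \<Lambda> \<gamma>" "dgr \<Lambda> \<mu> = axis i (b - a)"
    using loop_return[OF HNE _ s(7) _ s(3) _ s(8)] s(5) ab by auto
  then show ?thesis
    using s(10) \<nu>(3) ab(1) by (metis zero_less_diff)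
qed

text \<open>A loop that is not a cycle repeats a vertex. Removing the piece between the two visits,
  rather than keeping it, leaves a shorter loop that is still based at \<open>w\<close>.\<close>

lemma cycle_at_loop:
  assumes "is_loop \<Lambda> \<kappa>" "src \<Lambda> \<kappa> = w" "dgr \<Lambda> \<kappa> = axis i m" "m > 0"
  shows "\<exists>\<mu>\<in>unicolor_cycles \<Lambda> i. src \<Lambda> \<mu> = w"
  using assms
proof (induction m arbitrary: \<kappa> rule: less_induct)
  case (less m)
  have \<kappa>: "\<kappa> \<in> paths \<Lambda>" "rng \<Lambda> \<kappa> = w"
    using less.prems by (auto simp: is_loop_def)
  show ?case
  proof (cases "is_cycle \<Lambda> \<kappa>")
    case True
    then show ?thesis
      using less.prems by (auto simp: unicolor_cycles_def unicolor_iff)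
  next
    case False
    have "\<kappa> \<notin> vertices \<Lambda>"
      using less.prems by (simp add: vertices_def)
    then obtain p q where pq: "p < q" "q \<le> axis i m" "segment \<Lambda> \<kappa> p p = segment \<Lambda> \<kappa> q q"
      "\<not> (p = 0 \<and> q = axis i m)"
      using False less.prems unfolding is_cycle_def by metis
    obtain b where b: "q = axis i b" "b \<le> m"
      using le_axisE pq(2) by metis
    obtain a where a: "p = axis i a" "a < b"
      using le_axisE pq(1) b(1) by (metis less_le nat_less_le)
    have "dgr \<Lambda> \<kappa> = axis i a + axis i (b - a) + axis i (m - b)"
      using a b less.prems by (simp flip: axis_add)
    then obtain \<alpha> \<beta> \<gamma> where s: "\<alpha> \<in> paths \<Lambda>" "\<beta> \<in> paths \<Lambda>" "\<gamma> \<in> paths \<Lambda>"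
      "src \<Lambda> \<alpha> = rng \<Lambda> \<beta>" "src \<Lambda> \<beta> = rng \<Lambda> \<gamma>" "dgr \<Lambda> \<alpha> = axis i a" "dgr \<Lambda> \<beta> = axis i (b - a)"
      "dgr \<Lambda> \<gamma> = axis i (m - b)" "\<kappa> = cmp \<Lambda> (cmp \<Lambda> \<alpha> \<beta>) \<gamma>" "rng \<Lambda> \<alpha> = rng \<Lambda> \<kappa>" "src \<Lambda> \<gamma> = src \<Lambda> \<kappa>"
      using segmentE[OF \<kappa>(1)] by metis
    have "segment \<Lambda> \<kappa> q q = rng \<Lambda> \<gamma>"
      using segment_vertex[of "cmp \<Lambda> \<alpha> \<beta>" \<gamma> "axis i b"] s(1-9) a b
      by (simp add: cmp_closed src_cmp dgr_cmp flip: axis_add)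
    moreover have "segment \<Lambda> \<kappa> p p = rng \<Lambda> \<beta>"
      using segment_vertex[of \<alpha> "cmp \<Lambda> \<beta> \<gamma>" "axis i a"] s(1-9) a
      by (simp add: cmp_closed rng_cmp cmp_assoc)
    ultimately have "src \<Lambda> \<alpha> = rng \<Lambda> \<gamma>"
      using s(4) pq(3) by simp
    then have "is_loop \<Lambda> (cmp \<Lambda> \<alpha> \<gamma>)" "src \<Lambda> (cmp \<Lambda> \<alpha> \<gamma>) = w"
      "dgr \<Lambda> (cmp \<Lambda> \<alpha> \<gamma>) = axis i (a + (m - b))"
      using s(1,3,6,8,10,11) \<kappa> less.prems by (simp_all add: is_loop_def cmp_closed rng_cmp src_cmp dgr_cmp axis_add)
    \<comment> \<open>The pair excluded in the definition of a cycle is exactly the one whose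
      removal would leave a loop of length 0.\<close>
    moreover have "a \<noteq> 0 \<or> b \<noteq> m"
      using a(1) b(1) pq(4) by auto
    then have "a + (m - b) < m" "a + (m - b) > 0"
      using a(2) b(2) by linarith+
    ultimately show ?thesis
      using less.IH[of "a + (m - b)" "cmp \<Lambda> \<alpha> \<gamma>"] by simp
  qed
qed

section \<open>Paths that avoid a cycle, and powers of the cycle\<close>

text \<open>Avoiding \<open>\<mu>\<close> as a segment becomes the absence of a factorization
  through \<open>\<mu>\<close>. The guard
  \<open>dgr \<Lambda> \<mu> \<le> dgr \<Lambda> \<nu>\<close> disappears, since such a
  factorization forces it.\<close>

lemma tails_iff:
  assumes \<mu>: "\<mu> \<in> paths \<Lambda>" "dgr \<Lambda> \<mu> = axis i m"
  shows "\<nu> \<in> tails \<Lambda> i \<mu> t \<longleftrightarrow> (\<exists>n. \<nu> \<in> axis_paths_to i n (src \<Lambda> \<mu>) \<and> n mod m = t mod m) \<and>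
    \<not> (\<exists>\<alpha>\<in>paths \<Lambda>. \<exists>\<gamma>\<in>paths \<Lambda>. src \<Lambda> \<alpha> = rng \<Lambda> \<mu> \<and> src \<Lambda> \<mu> = rng \<Lambda> \<gamma> \<and> \<nu> = cmp \<Lambda> (cmp \<Lambda> \<alpha> \<mu>) \<gamma>)"
    (is "_ \<longleftrightarrow> ?A \<and> \<not> ?C")
proof -
  let ?S = "dgr \<Lambda> \<mu> \<le> dgr \<Lambda> \<nu> \<longrightarrow>
        (\<forall>n \<le> dgr \<Lambda> \<nu> - dgr \<Lambda> \<mu>. segment \<Lambda> \<nu> n (n + dgr \<Lambda> \<mu>) \<noteq> \<mu>)"
  have S: "?S \<longleftrightarrow> \<not> ?C" if "\<nu> \<in> paths \<Lambda>"
  proof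
    assume S: ?S
    show "\<not> ?C"
    proof
      assume ?C
      then obtain \<alpha> \<gamma> where s: "\<alpha> \<in> paths \<Lambda>" "\<gamma> \<in> paths \<Lambda>" "src \<Lambda> \<alpha> = rng \<Lambda> \<mu>" "src \<Lambda> \<mu> = rng \<Lambda> \<gamma>"
        "\<nu> = cmp \<Lambda> (cmp \<Lambda> \<alpha> \<mu>) \<gamma>" by blast
      have "dgr \<Lambda> \<nu> = dgr \<Lambda> \<alpha> + dgr \<Lambda> \<mu> + dgr \<Lambda> \<gamma>"
        using s \<mu>(1) by (simp add: dgr_cmp cmp_closed src_cmp)
      then have "dgr \<Lambda> \<mu> \<le> dgr \<Lambda> \<nu>" "dgr \<Lambda> \<alpha> \<le> dgr \<Lambda> \<nu> - dgr \<Lambda> \<mu>"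
        by (simp_all add: less_eq_vec_def)
      then show False
        using S segment_eq[OF s(1) \<mu>(1) s(2-4) refl refl] s(5) by blast
    qed
  next
    assume C: "\<not> ?C"
    show ?S
    proof (intro impI allI notI)
      fix p assume *: "dgr \<Lambda> \<mu> \<le> dgr \<Lambda> \<nu>" "p \<le> dgr \<Lambda> \<nu> - dgr \<Lambda> \<mu>" "segment \<Lambda> \<nu> p (p + dgr \<Lambda> \<mu>) = \<mu>"
      have le: "dgr \<Lambda> \<mu> $ j \<le> dgr \<Lambda> \<nu> $ j" "p $ j \<le> dgr \<Lambda> \<nu> $ j - dgr \<Lambda> \<mu> $ j" for j
        using *(1,2) by (simp_all add: less_eq_vec_def)
      \<comment> \<open>Subtraction of degrees is truncated; the bounds \<open>le\<close> make it
        exact in each coordinate.\<close>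
      have "dgr \<Lambda> \<nu> $ j = p $ j + dgr \<Lambda> \<mu> $ j + (dgr \<Lambda> \<nu> $ j - dgr \<Lambda> \<mu> $ j - p $ j)" for j
        using le[of j] by linarith
      then have "dgr \<Lambda> \<nu> = p + dgr \<Lambda> \<mu> + (dgr \<Lambda> \<nu> - dgr \<Lambda> \<mu> - p)"
        by (simp add: vec_eq_iff)
      from segmentE[OF that this] C *(3) show False
        by metis
    qed
  qed
  have A: "?A \<longleftrightarrow> \<nu> \<in> paths \<Lambda> \<and> src \<Lambda> \<nu> = src \<Lambda> \<mu> \<and> unicolor \<Lambda> i \<nu> \<and>
     path_length \<Lambda> \<nu> mod path_length \<Lambda> \<mu> = t mod path_length \<Lambda> \<mu>"
    using \<mu>(2) by (auto simp: axis_paths_to_def unicolor_iff path_length_axis)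
  show ?thesis
  proof (cases "\<nu> \<in> paths \<Lambda>")
    case True
    show ?thesis
      unfolding A S[OF True, symmetric] tails_def by blast
  next
    case False
    then show ?thesis
      by (simp add: tails_def axis_paths_to_def)
  qed
qed

text \<open>As \<open>\<nu>\<close> ends at the base point of \<open>\<mu>\<close>, so does
  \<open>\<gamma>\<close>, which also begins there. Then \<open>\<mu>\<close> followed by
  \<open>\<gamma>\<close> and \<open>\<gamma>\<close> followed by \<open>\<mu>\<close> are paths of
  equal length from the base point, hence equal by \<open>paths_from_loop_unique\<close>, and the
  copy of \<open>\<mu>\<close> slides to the end.\<close>

lemma axis_paths_to_ending:
  assumes HNE: "HNE \<Lambda>" and loop: "is_loop \<Lambda> \<mu>" and d: "dgr \<Lambda> \<mu> = axis i m" and m: "m > 0"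
    and \<nu>: "\<nu> \<in> axis_paths_to i n (src \<Lambda> \<mu>)"
    and s: "\<alpha> \<in> paths \<Lambda>" "\<gamma> \<in> paths \<Lambda>" "src \<Lambda> \<alpha> = rng \<Lambda> \<mu>" "src \<Lambda> \<mu> = rng \<Lambda> \<gamma>"
      "\<nu> = cmp \<Lambda> (cmp \<Lambda> \<alpha> \<mu>) \<gamma>"
  shows "m \<le> n \<and> (\<exists>\<nu>'\<in>axis_paths_to i (n - m) (src \<Lambda> \<mu>). \<nu> = cmp \<Lambda> \<nu>' \<mu>)"
proof -
  have \<mu>: "\<mu> \<in> paths \<Lambda>" "rng \<Lambda> \<mu> = src \<Lambda> \<mu>"
    using loop by (auto simp: is_loop_def)
  have \<nu>': "dgr \<Lambda> \<nu> = axis i n" "src \<Lambda> \<nu> = src \<Lambda> \<mu>"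
    using \<nu> by (auto simp: axis_paths_to_def)
  have sum: "axis i n = dgr \<Lambda> \<alpha> + axis i m + dgr \<Lambda> \<gamma>"
    using s(1-4) \<mu>(1) d unfolding \<nu>'(1)[symmetric] s(5) by (simp add: dgr_cmp cmp_closed src_cmp)
  have "dgr \<Lambda> \<alpha> \<le> axis i n" "dgr \<Lambda> \<gamma> \<le> axis i n"
    unfolding sum by (simp_all add: less_eq_vec_def)
  then obtain a g where ag: "dgr \<Lambda> \<alpha> = axis i a" "dgr \<Lambda> \<gamma> = axis i g"
    using le_axisE by metis
  have n: "n = a + m + g"
    using sum unfolding ag by (auto simp: axis_eq_axis simp flip: axis_add)
  have src\<gamma>: "src \<Lambda> \<gamma> = src \<Lambda> \<mu>"
    using \<nu>'(2) s(1-4) \<mu>(1) unfolding s(5) by (simp add: src_cmp cmp_closed)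
  have "cmp \<Lambda> \<mu> \<gamma> = cmp \<Lambda> \<gamma> \<mu>"
    using paths_from_loop_unique[OF HNE loop d m, of "cmp \<Lambda> \<mu> \<gamma>" "m + g" "cmp \<Lambda> \<gamma> \<mu>"] \<mu> s(2,4) src\<gamma> d ag
    by (simp add: cmp_closed rng_cmp dgr_cmp axis_add add.commute)
  then have "\<nu> = cmp \<Lambda> (cmp \<Lambda> \<alpha> \<gamma>) \<mu>"
    using s(1-4) \<mu> src\<gamma> unfolding s(5) by (simp add: cmp_assoc)
  moreover have "cmp \<Lambda> \<alpha> \<gamma> \<in> axis_paths_to i (n - m) (src \<Lambda> \<mu>)"
    using s(1-4) \<mu> src\<gamma> ag n
    by (simp add: axis_paths_to_def cmp_closed dgr_cmp src_cmp axis_add)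
  ultimately show ?thesis
    using n by auto
qed

lemma finite_axis_paths_to:
  assumes "row_finite_no_sources \<Lambda>" "finite (vertices \<Lambda>)"
  shows "finite (axis_paths_to i n w)"
proof (rule finite_subset)
  show "axis_paths_to i n w \<subseteq> (\<Union>v\<in>vertices \<Lambda>. paths_from \<Lambda> v (axis i n))"
    by (auto simp: axis_paths_to_def paths_from_def rng_in_vertices)
  show "finite (\<Union>v\<in>vertices \<Lambda>. paths_from \<Lambda> v (axis i n))"
    using assms by (auto simp: row_finite_no_sources_def)
qed

text \<open>
  By HNE, a path ending at the base point of a cycle factors uniquely as a path avoiding the
  cycle followed by a power of the cycle.
\<close>

lemma card_axis_paths_to:
  assumes rf: "row_finite_no_sources \<Lambda>" "finite (vertices \<Lambda>)" and HNE: "HNE \<Lambda>"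
    and loop: "is_loop \<Lambda> \<mu>" and d: "dgr \<Lambda> \<mu> = axis i m" and m: "m > 0"
    and fin: "\<And>t. finite (tails \<Lambda> i \<mu> t)"
  shows "card (axis_paths_to i n (src \<Lambda> \<mu>)) = card {\<nu> \<in> tails \<Lambda> i \<mu> n. path_length \<Lambda> \<nu> \<le> n}"
proof (induction n rule: less_induct)
  case (less n)
  let ?X = "\<lambda>n. axis_paths_to i n (src \<Lambda> \<mu>)"
  let ?T = "\<lambda>n. {\<nu> \<in> tails \<Lambda> i \<mu> n. path_length \<Lambda> \<nu> \<le> n}"
  have \<mu>: "\<mu> \<in> paths \<Lambda>" "rng \<Lambda> \<mu> = src \<Lambda> \<mu>"
    using loop by (auto simp: is_loop_def)
  have len: "\<nu> \<in> ?X (path_length \<Lambda> \<nu>)" "path_length \<Lambda> \<nu> mod m = t mod m" if "\<nu> \<in> tails \<Lambda> i \<mu> t" for \<nu> t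
    using that tails_iff[OF \<mu>(1) d] by (auto simp: axis_paths_to_def path_length_axis)
  have lenX: "path_length \<Lambda> \<nu> = n" if "\<nu> \<in> ?X n" for \<nu> n
    using that by (simp add: axis_paths_to_def path_length_axis)
  \<comment> \<open>\<open>Y\<close> collects the paths that end in a copy of \<open>\<mu>\<close>.
    The case \<open>n < m\<close> is split off because \<open>n - m\<close> would be truncated to 0
    and contribute \<open>\<mu>\<close>, which has the wrong length.\<close>
  define Y where "Y = (if n < m then {} else (\<lambda>\<nu>. cmp \<Lambda> \<nu> \<mu>) ` ?X (n - m))"
  have YX: "Y \<subseteq> ?X n"
    using \<mu> d by (auto simp: Y_def axis_paths_to_def cmp_closed dgr_cmp src_cmp simp flip: axis_add)
  \<comment> \<open>By \<open>axis_paths_to_ending\<close> a path that meets \<open>\<mu>\<close>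
    anywhere ends in it, so the paths avoiding \<open>\<mu>\<close> are those outside
    \<open>Y\<close>.\<close>
  have tails: "?X n \<inter> tails \<Lambda> i \<mu> n = ?X n - Y"
  proof (intro equalityI subsetI)
    fix \<nu> assume \<nu>: "\<nu> \<in> ?X n \<inter> tails \<Lambda> i \<mu> n"
    have "\<nu> \<notin> Y"
    proof
      assume "\<nu> \<in> Y"
      then obtain \<alpha> where "\<alpha> \<in> ?X (n - m)" "\<nu> = cmp \<Lambda> \<alpha> \<mu>"
        by (auto simp: Y_def split: if_splits)
      \<comment> \<open>An occurrence at the very end is a factorization whose last piece is the
        identity \<open>src \<Lambda> \<mu>\<close>.\<close>
      then have "\<alpha> \<in> paths \<Lambda>" "src \<Lambda> \<alpha> = rng \<Lambda> \<mu>" "\<nu> = cmp \<Lambda> (cmp \<Lambda> \<alpha> \<mu>) (src \<Lambda> \<mu>)"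
        using \<mu> cmp_src[of "cmp \<Lambda> \<alpha> \<mu>"] by (simp_all add: axis_paths_to_def cmp_closed src_cmp)
      moreover have "src \<Lambda> \<mu> \<in> paths \<Lambda>" "src \<Lambda> \<mu> = rng \<Lambda> (src \<Lambda> \<mu>)"
        using \<mu>(1) by (simp_all add: src_closed rng_src)
      ultimately show False
        using \<nu> unfolding tails_iff[OF \<mu>(1) d] Int_iff by blast
    qed
    then show "\<nu> \<in> ?X n - Y"
      using \<nu> by simp
  next
    fix \<nu> assume \<nu>: "\<nu> \<in> ?X n - Y"
    have "\<nu> \<in> tails \<Lambda> i \<mu> n"
      unfolding tails_iff[OF \<mu>(1) d]
    proof (intro conjI notI)
      show "\<exists>n'. \<nu> \<in> ?X n' \<and> n' mod m = n mod m"
        using \<nu> by auto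
      assume "\<exists>\<alpha>\<in>paths \<Lambda>. \<exists>\<gamma>\<in>paths \<Lambda>. src \<Lambda> \<alpha> = rng \<Lambda> \<mu> \<and> src \<Lambda> \<mu> = rng \<Lambda> \<gamma> \<and> \<nu> = cmp \<Lambda> (cmp \<Lambda> \<alpha> \<mu>) \<gamma>"
      then have "m \<le> n \<and> (\<exists>\<nu>'\<in>?X (n - m). \<nu> = cmp \<Lambda> \<nu>' \<mu>)"
        using axis_paths_to_ending[OF HNE loop d m] \<nu> by blast
      then show False
        using \<nu> by (auto simp: Y_def)
    qed
    then show "\<nu> \<in> ?X n \<inter> tails \<Lambda> i \<mu> n"
      using \<nu> by simp
  qed
  have finX: "finite (?X n)"
    by (rule finite_axis_paths_to[OF rf])
  have cardX: "card (?X n) = card Y + card (?X n \<inter> tails \<Lambda> i \<mu> n)"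
    unfolding tails using card_Diff_subset[OF finite_subset[OF YX finX] YX] card_mono[OF finX YX] by simp
  show ?case
  proof (cases "n < m")
    case True
    \<comment> \<open>The length of a tail counted here and \<open>n\<close> are both below
      \<open>m\<close> and congruent modulo \<open>m\<close>.\<close>
    have "?T n = ?X n \<inter> tails \<Lambda> i \<mu> n"
    proof (intro equalityI subsetI)
      fix \<nu> assume \<nu>: "\<nu> \<in> ?T n"
      then have "path_length \<Lambda> \<nu> = n"
        using len(2)[of \<nu> n] True by simp
      then show "\<nu> \<in> ?X n \<inter> tails \<Lambda> i \<mu> n"
        using \<nu> len(1)[of \<nu> n] by auto
    qed (use lenX in auto)
    then show ?thesis
      using cardX True by (simp add: Y_def)
  next
    case False
    have "inj_on (\<lambda>\<nu>. cmp \<Lambda> \<nu> \<mu>) (?X (n - m))"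
      using \<mu> by (auto intro!: inj_onI elim!: cmp_cancel_right[rotated -1] simp: axis_paths_to_def)
    \<comment> \<open>Right composition with \<open>\<mu>\<close> is injective by cancellation, so
      the induction hypothesis for \<open>n - m\<close> counts \<open>Y\<close>.\<close>
    then have "card Y = card (?T (n - m))"
      using False m less.IH[of "n - m"] by (simp add: Y_def card_image)
    moreover have "?T n = ?T (n - m) \<union> (?X n \<inter> tails \<Lambda> i \<mu> n)"
    proof -
      have mod: "(n - m) mod m = n mod m"
        using False by (simp add: le_mod_geq)
      then have eq: "tails \<Lambda> i \<mu> (n - m) = tails \<Lambda> i \<mu> n"
        by (auto simp: tails_def path_length_axis[OF d])
      \<comment> \<open>No length congruent to \<open>n\<close> modulo \<open>m\<close> lies
        strictly between \<open>n - m\<close> and \<open>n\<close>, so passing from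
        \<open>n - m\<close> to \<open>n\<close> adds just the tails of length
        \<open>n\<close>.\<close>
      have "l \<le> n - m \<or> l = n" if "l \<le> n" "l mod m = n mod m" for l
      proof (rule ccontr)
        assume "\<not> (l \<le> n - m \<or> l = n)"
        then have "n - l < m" "n - l > 0"
          using that False by auto
        moreover have "m dvd n - l"
          using that by (metis mod_eq_dvd_iff_nat)
        ultimately show False
          by (auto dest: nat_dvd_not_less)
      qed
      then show ?thesis
        unfolding eq using len lenX by fastforce
    qed
    moreover have "?T (n - m) \<inter> (?X n \<inter> tails \<Lambda> i \<mu> n) = {}"
      using lenX m False by fastforce
    ultimately show ?thesis
      using cardX card_Un_disjoint[of "?T (n - m)" "?X n \<inter> tails \<Lambda> i \<mu> n"] fin finX by simp
  qed
qed

text \<open>At the base point of a cycle the count is the number of tails of length at most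
  \<open>n\<close> in the residue class of \<open>n\<close>; once \<open>n\<close> reaches the
  longest tail this is the constant of HEDL. At any other vertex a long path would yield a loop and
  then a cycle, so the count is eventually 0.\<close>

lemma card_axis_paths_to_eventually_const:
  assumes rf: "row_finite_no_sources \<Lambda>" "finite (vertices \<Lambda>)" and HNE: "HNE \<Lambda>" and HEDL: "HEDL \<Lambda>"
  shows "\<exists>N l. \<forall>n\<ge>N. card (axis_paths_to i n w) = l"
proof (cases "\<exists>\<mu>\<in>unicolor_cycles \<Lambda> i. src \<Lambda> \<mu> = w")
  case True
  then obtain \<mu> where \<mu>: "\<mu> \<in> unicolor_cycles \<Lambda> i" "src \<Lambda> \<mu> = w" by blast
  then have loop: "is_loop \<Lambda> \<mu>" and "\<mu> \<notin> vertices \<Lambda>" and "unicolor \<Lambda> i \<mu>"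
    by (auto simp: unicolor_cycles_def is_cycle_def)
  then obtain m where d: "dgr \<Lambda> \<mu> = axis i m" and m: "m > 0"
    by (auto simp: unicolor_iff vertices_def is_loop_def)
  obtain l where l: "l > 0" "\<And>t. t < m \<Longrightarrow> card (tails \<Lambda> i \<mu> t) = l"
    using HEDL \<mu>(1) path_length_axis[OF d] unfolding HEDL_def by metis
  \<comment> \<open>HEDL speaks of \<open>t < m\<close>; the sets depend on \<open>t\<close> modulo
    \<open>m\<close>, which carries it over to every \<open>t\<close>.\<close>
  have tails_mod: "tails \<Lambda> i \<mu> t = tails \<Lambda> i \<mu> (t mod m)" for t
    by (simp add: tails_def path_length_axis[OF d])
  have card_tails: "card (tails \<Lambda> i \<mu> t) = l" for t
    using l(2)[of "t mod m"] m tails_mod[of t] by simp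
  \<comment> \<open>An infinite set has \<open>card\<close> equal to 0, against
    \<open>l > 0\<close>.\<close>
  have fin: "finite (tails \<Lambda> i \<mu> t)" for t
    using card_tails[of t] l(1) card_ge_0_finite by metis
  define N where "N = Max (insert 0 (path_length \<Lambda> ` (\<Union>t<m. tails \<Lambda> i \<mu> t)))"
  have N: "path_length \<Lambda> \<nu> \<le> N" if "\<nu> \<in> tails \<Lambda> i \<mu> t" for \<nu> t
  proof -
    have "\<nu> \<in> (\<Union>t<m. tails \<Lambda> i \<mu> t)"
      using that tails_mod[of t] m mod_less_divisor by blast
    then show ?thesis
      unfolding N_def using fin by (intro Max_ge) auto
  qed
  have "card (axis_paths_to i n w) = l" if "n \<ge> N" for n
  proof -
    have "{\<nu> \<in> tails \<Lambda> i \<mu> n. path_length \<Lambda> \<nu> \<le> n} = tails \<Lambda> i \<mu> n"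
      using N that order_trans by blast
    then show ?thesis
      using card_axis_paths_to[OF rf HNE loop d m fin, of n] \<mu>(2) card_tails by simp
  qed
  then show ?thesis by blast
next
  case False
  then have "axis_paths_to i n w = {}" if "n \<ge> card (vertices \<Lambda>)" for n
    using loop_if_long_path[OF HNE rf(2) _ that] cycle_at_loop by blast
  then have "\<forall>n\<ge>card (vertices \<Lambda>). card (axis_paths_to i n w) = 0"
    by simp
  then show ?thesis by blast
qed

section \<open>A source-preserving bijection between neighbouring degrees\<close>

definition paths_of_degree :: "nat ^ 'k \<Rightarrow> 'a set" where
  "paths_of_degree n = {\<nu> \<in> paths \<Lambda>. dgr \<Lambda> \<nu> = n}"

text \<open>For each source the counts in lengths \<open>Suc n\<close> and \<open>n\<close> agree
  from some point on, and equal finite cardinality gives a bijection. Finitely many sources allow a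
  common \<open>N\<close>; the bijections are then glued along the source.\<close>

lemma paths_of_degree_bij:
  assumes rf: "row_finite_no_sources \<Lambda>" "finite (vertices \<Lambda>)" and HNE: "HNE \<Lambda>" and HEDL: "HEDL \<Lambda>"
  shows "\<exists>N \<sigma>. bij_betw \<sigma> (paths_of_degree (axis i (Suc N))) (paths_of_degree (axis i N)) \<and>
    (\<forall>\<nu>\<in>paths_of_degree (axis i (Suc N)). src \<Lambda> (\<sigma> \<nu>) = src \<Lambda> \<nu>)"
proof -
  have "\<forall>w. \<exists>N. \<forall>n\<ge>N. card (axis_paths_to i (Suc n) w) = card (axis_paths_to i n w)"
    using card_axis_paths_to_eventually_const[OF assms] by (metis le_Suc_eq)
  then obtain M where M: "\<And>w n. n \<ge> M w \<Longrightarrow> card (axis_paths_to i (Suc n) w) = card (axis_paths_to i n w)"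
    by metis
  define N where "N = Max (insert 0 (M ` vertices \<Lambda>))"
  have "M w \<le> N" if "w \<in> vertices \<Lambda>" for w
    unfolding N_def using that rf(2) by (intro Max_ge) auto
  then have "\<exists>f. bij_betw f (axis_paths_to i (Suc N) w) (axis_paths_to i N w)" if "w \<in> vertices \<Lambda>" for w
    using that M finite_axis_paths_to[OF rf] by (intro finite_same_card_bij) auto
  then obtain f where f: "\<And>w. w \<in> vertices \<Lambda> \<Longrightarrow> bij_betw (f w) (axis_paths_to i (Suc N) w) (axis_paths_to i N w)"
    by metis
  define \<sigma> where "\<sigma> \<nu> = f (src \<Lambda> \<nu>) \<nu>" for \<nu>
  have U: "paths_of_degree (axis i n) = (\<Union>w\<in>vertices \<Lambda>. axis_paths_to i n w)" for n
    by (auto simp: paths_of_degree_def axis_paths_to_def src_in_vertices)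
  have bij: "bij_betw \<sigma> (axis_paths_to i (Suc N) w) (axis_paths_to i N w)" if "w \<in> vertices \<Lambda>" for w
    using f[OF that] by (rule bij_betw_cong[THEN iffD1, rotated]) (simp add: \<sigma>_def axis_paths_to_def)
  have "bij_betw \<sigma> (paths_of_degree (axis i (Suc N))) (paths_of_degree (axis i N))"
    unfolding U
  proof (rule bij_betw_UNION_disjoint)
    show "disjoint_family_on (axis_paths_to i N) (vertices \<Lambda>)"
      by (auto simp: disjoint_family_on_def axis_paths_to_def)
  qed (rule bij)
  moreover have "src \<Lambda> (\<sigma> \<nu>) = src \<Lambda> \<nu>" if "\<nu> \<in> paths_of_degree (axis i (Suc N))" for \<nu>
  proof -
    have "\<nu> \<in> axis_paths_to i (Suc N) (src \<Lambda> \<nu>)" "src \<Lambda> \<nu> \<in> vertices \<Lambda>"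
      using that by (auto simp: paths_of_degree_def axis_paths_to_def src_in_vertices)
    then have "\<sigma> \<nu> \<in> axis_paths_to i N (src \<Lambda> \<nu>)"
      using bij bij_betwE by blast
    then show ?thesis
      by (simp add: axis_paths_to_def)
  qed
  ultimately show ?thesis by blast
qed

end

section \<open>Congruence modulo the relations\<close>

lemma poly_mapping_expand: "x = (\<Sum>w\<in>Poly_Mapping.keys x. Poly_Mapping.single w (Poly_Mapping.lookup x w))"
  by (rule poly_mapping_eqI)
    (auto simp: lookup_sum lookup_single when_def sum.delta' not_in_keys_iff_lookup_eq_zero
      cong: if_cong)

text \<open>The product is not commutative, but the empty word is neutral on both sides and the
  coefficients commute, so scalars are central.\<close>

lemma single_0_mult_commute:
  fixes x :: "'w::monoid_add \<Rightarrow>\<^sub>0 'f::comm_ring_1"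
  shows "Poly_Mapping.single 0 c * x = x * Poly_Mapping.single 0 c"
  by (subst (1 2) poly_mapping_expand)
    (simp add: sum_distrib_left sum_distrib_right mult_single mult.commute)

lemma kp_free_0: "0 \<in> kp_free \<Lambda>"
  by (simp add: kp_free_def)

lemma kp_free_add: "x \<in> kp_free \<Lambda> \<Longrightarrow> y \<in> kp_free \<Lambda> \<Longrightarrow> x + y \<in> kp_free \<Lambda>"
  using keys_add[of x y] by (fastforce simp: kp_free_def)

lemma kp_free_uminus: "x \<in> kp_free \<Lambda> \<Longrightarrow> - x \<in> kp_free \<Lambda>"
  by (simp add: kp_free_def)

lemma kp_free_diff: "x \<in> kp_free \<Lambda> \<Longrightarrow> y \<in> kp_free \<Lambda> \<Longrightarrow> x - y \<in> kp_free \<Lambda>"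
  using keys_diff[of x y] by (fastforce simp: kp_free_def)

lemma kp_free_mult: "x \<in> kp_free \<Lambda> \<Longrightarrow> y \<in> kp_free \<Lambda> \<Longrightarrow> x * y \<in> kp_free \<Lambda>"
  using keys_mult[of x y] by (fastforce simp: kp_free_def plus_free_word_def)

lemma kp_free_scale: "x \<in> kp_free \<Lambda> \<Longrightarrow> Poly_Mapping.single 0 c * x \<in> kp_free \<Lambda>"
  using keys_mult[of "Poly_Mapping.single 0 c" x]
  by (fastforce simp: kp_free_def split: if_splits)

lemma kp_free_sum: "(\<And>i. i \<in> A \<Longrightarrow> f i \<in> kp_free \<Lambda>) \<Longrightarrow> sum f A \<in> kp_free \<Lambda>"
  by (induction A rule: infinite_finite_induct) (auto simp: kp_free_0 kp_free_add)

lemma kp_free_single: "letters w \<noteq> [] \<Longrightarrow> set (letters w) \<subseteq> kp_gens \<Lambda> \<Longrightarrow> Poly_Mapping.single w c \<in> kp_free \<Lambda>"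
  by (simp add: kp_free_def)

lemma kp_p_in_free: "v \<in> vertices \<Lambda> \<Longrightarrow> kp_p v \<in> kp_free \<Lambda>"
  by (simp add: kp_p_def kp_free_single kp_gens_def)

lemma kp_s_in_free: "\<nu> \<in> paths \<Lambda> \<Longrightarrow> kp_s \<Lambda> \<nu> \<in> kp_free \<Lambda>"
  by (simp add: kp_s_def kp_p_in_free kp_free_single kp_gens_def)

lemma kp_s_star_in_free: "\<nu> \<in> paths \<Lambda> \<Longrightarrow> kp_s_star \<Lambda> \<nu> \<in> kp_free \<Lambda>"
  by (simp add: kp_s_star_def kp_p_in_free kp_free_single kp_gens_def)

lemmas kp_free_intros = kp_free_0 kp_free_add kp_free_uminus kp_free_diff kp_free_mult kp_free_scale
  kp_free_sum kp_p_in_free kp_s_in_free kp_s_star_in_free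

lemma kp_gen_cases:
  assumes "g \<in> kp_gens \<Lambda>"
  shows "\<exists>\<nu>\<in>paths \<Lambda>. Poly_Mapping.single (Word [g]) 1 = kp_s \<Lambda> \<nu> \<or> Poly_Mapping.single (Word [g]) 1 = kp_s_star \<Lambda> \<nu>"
  using assms by (force simp: kp_gens_def kp_s_def kp_s_star_def kp_p_def vertices_def)

text \<open>Nonempty words grow from a single letter by appending letters on the right; scalars and
  sums do the rest. Every letter is some \<open>kp_s\<close> or \<open>kp_s_star\<close>, a vertex
  being both. Right multiplication is the form in which spans and the unit laws are
  propagated.\<close>

lemma kp_free_induct [consumes 1, case_names zero add scale s star mult_s mult_star]:
  fixes x :: "'a kp_gen free_word \<Rightarrow>\<^sub>0 'f::field"
  assumes x: "x \<in> kp_free \<Lambda>"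
    and zero: "P 0"
    and add: "\<And>x y. \<lbrakk>x \<in> kp_free \<Lambda>; y \<in> kp_free \<Lambda>; P x; P y\<rbrakk> \<Longrightarrow> P (x + y)"
    and scale: "\<And>c x. \<lbrakk>x \<in> kp_free \<Lambda>; P x\<rbrakk> \<Longrightarrow> P (Poly_Mapping.single 0 c * x)"
    and s: "\<And>\<nu>. \<nu> \<in> paths \<Lambda> \<Longrightarrow> P (kp_s \<Lambda> \<nu>)"
    and star: "\<And>\<nu>. \<nu> \<in> paths \<Lambda> \<Longrightarrow> P (kp_s_star \<Lambda> \<nu>)"
    and mult_s: "\<And>x \<nu>. \<lbrakk>x \<in> kp_free \<Lambda>; P x; \<nu> \<in> paths \<Lambda>\<rbrakk> \<Longrightarrow> P (x * kp_s \<Lambda> \<nu>)"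
    and mult_star: "\<And>x \<nu>. \<lbrakk>x \<in> kp_free \<Lambda>; P x; \<nu> \<in> paths \<Lambda>\<rbrakk> \<Longrightarrow> P (x * kp_s_star \<Lambda> \<nu>)"
  shows "P x"
proof -
  have word: "P (Poly_Mapping.single (Word ws) 1)" if "ws \<noteq> []" "set ws \<subseteq> kp_gens \<Lambda>" for ws
    using that
  proof (induction ws rule: rev_nonempty_induct)
    case (single g)
    then obtain \<nu> where "\<nu> \<in> paths \<Lambda>"
      "Poly_Mapping.single (Word [g]) (1::'f) = kp_s \<Lambda> \<nu> \<or> Poly_Mapping.single (Word [g]) (1::'f) = kp_s_star \<Lambda> \<nu>"
      using kp_gen_cases[of g \<Lambda>] by auto
    then show ?case
      using s[of \<nu>] star[of \<nu>] by (elim disjE) simp_all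
  next
    case (snoc g ws)
    then obtain \<nu> where "\<nu> \<in> paths \<Lambda>"
      "Poly_Mapping.single (Word [g]) (1::'f) = kp_s \<Lambda> \<nu> \<or> Poly_Mapping.single (Word [g]) (1::'f) = kp_s_star \<Lambda> \<nu>"
      using kp_gen_cases[of g \<Lambda>] by auto
    moreover
    have "Poly_Mapping.single (Word (ws @ [g])) 1 =
        Poly_Mapping.single (Word ws) 1 * Poly_Mapping.single (Word [g]) (1 :: 'f)"
      by (simp add: mult_single plus_free_word_def)
    moreover have "Poly_Mapping.single (Word ws) 1 \<in> kp_free \<Lambda>"
      using snoc by (intro kp_free_single) auto
    moreover have "P (Poly_Mapping.single (Word ws) 1)"
      using snoc by simp
    ultimately show ?case
      using mult_s[of "Poly_Mapping.single (Word ws) 1" \<nu>] mult_star[of "Poly_Mapping.single (Word ws) 1" \<nu>]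
      by (elim disjE) simp_all
  qed
  have "P (\<Sum>w\<in>A. Poly_Mapping.single w (Poly_Mapping.lookup x w))" if "finite A" "A \<subseteq> Poly_Mapping.keys x" for A
    using that
  proof (induction A rule: finite_induct)
    case (insert w A)
    have w: "letters w \<noteq> []" "set (letters w) \<subseteq> kp_gens \<Lambda>" if "w \<in> Poly_Mapping.keys x" for w
      using x that by (auto simp: kp_free_def)
    have "P (Poly_Mapping.single 0 (Poly_Mapping.lookup x w) * Poly_Mapping.single (Word (letters w)) 1)"
      using w insert by (intro scale word kp_free_single) auto
    moreover have "(\<Sum>w\<in>A. Poly_Mapping.single w (Poly_Mapping.lookup x w)) \<in> kp_free \<Lambda>"
      using insert w by (intro kp_free_sum kp_free_single) auto
    ultimately show ?case
      using insert w kp_free_single[of w \<Lambda>] by (auto simp: mult_single intro!: add)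
  qed (simp add: zero)
  then have "P (\<Sum>w\<in>Poly_Mapping.keys x. Poly_Mapping.single w (Poly_Mapping.lookup x w))"
    by simp
  then show ?thesis
    using poly_mapping_expand[of x] by simp
qed

lemma kp_ideal_uminus: "x \<in> kp_ideal \<Lambda> \<Longrightarrow> - x \<in> kp_ideal \<Lambda>"
  using kp_ideal.scale[of x \<Lambda> "-1"] by (simp add: single_uminus)

lemma kp_ideal_sum: "(\<And>i. i \<in> A \<Longrightarrow> f i \<in> kp_ideal \<Lambda>) \<Longrightarrow> sum f A \<in> kp_ideal \<Lambda>"
  by (induction A rule: infinite_finite_induct) (auto intro: kp_ideal.intros)

context k_graph
begin

section \<open>The ideal and its congruence\<close>

lemma kp_relations_subset_free: "kp_relations \<Lambda> \<subseteq> kp_free \<Lambda>"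
proof
  fix x :: "'a kp_gen free_word \<Rightarrow>\<^sub>0 'f::field"
  assume "x \<in> kp_relations \<Lambda>"
  then show "x \<in> kp_free \<Lambda>"
    by cases
      (auto intro!: kp_free_intros cmp_closed rng_in_vertices src_in_vertices simp: paths_from_def)
qed

lemma kp_ideal_subset_free: "x \<in> kp_ideal \<Lambda> \<Longrightarrow> x \<in> kp_free \<Lambda>"
  by (induction rule: kp_ideal.induct) (use kp_relations_subset_free in \<open>auto intro: kp_free_intros\<close>)

text \<open>Equality in the quotient, expressed on representatives: calculations with generators are
  made in the free algebra and pass to cosets by \<open>cls_eq_iff\<close>.\<close>

definition kp_cong :: "('a kp_gen free_word \<Rightarrow>\<^sub>0 'f::field) \<Rightarrow> ('a kp_gen free_word \<Rightarrow>\<^sub>0 'f) \<Rightarrow> bool"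
    (infix \<open>\<approx>\<close> 50) where
  "x \<approx> y \<longleftrightarrow> x - y \<in> kp_ideal \<Lambda>"

lemma cong_refl [simp]: "x \<approx> x"
  by (simp add: kp_cong_def kp_ideal.zero)

lemma cong_sym: "x \<approx> y \<Longrightarrow> y \<approx> x"
  unfolding kp_cong_def using kp_ideal_uminus by fastforce

lemma cong_trans [trans]: "x \<approx> y \<Longrightarrow> y \<approx> z \<Longrightarrow> x \<approx> z"
  unfolding kp_cong_def using kp_ideal.add by fastforce

lemma cong_add: "x \<approx> x' \<Longrightarrow> y \<approx> y' \<Longrightarrow> x + y \<approx> x' + y'"
  unfolding kp_cong_def by (metis add_diff_add kp_ideal.add)

lemma cong_scale: "x \<approx> x' \<Longrightarrow> Poly_Mapping.single 0 c * x \<approx> Poly_Mapping.single 0 c * x'"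
  unfolding kp_cong_def using kp_ideal.scale by (metis right_diff_distrib)

lemma cong_sum: "(\<And>i. i \<in> A \<Longrightarrow> f i \<approx> g i) \<Longrightarrow> sum f A \<approx> sum g A"
  by (induction A rule: infinite_finite_induct) (auto simp: cong_add)

lemma cong_mult_left: "y \<approx> y' \<Longrightarrow> x \<in> kp_free \<Lambda> \<Longrightarrow> x * y \<approx> x * y'"
  unfolding kp_cong_def using kp_ideal.mult_left by (metis right_diff_distrib)

lemma cong_mult_right: "x \<approx> x' \<Longrightarrow> y \<in> kp_free \<Lambda> \<Longrightarrow> x * y \<approx> x' * y"
  unfolding kp_cong_def using kp_ideal.mult_right by (metis left_diff_distrib)

text \<open>First \<open>y\<close> is replaced with multiplier \<open>x\<close>, then
  \<open>x\<close> with multiplier \<open>y'\<close>. The ideal absorbs elements of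
  \<open>kp_free\<close>, whence the side conditions on these two.\<close>

lemma cong_mult: "x \<approx> x' \<Longrightarrow> y \<approx> y' \<Longrightarrow> x \<in> kp_free \<Lambda> \<Longrightarrow> y' \<in> kp_free \<Lambda> \<Longrightarrow> x * y \<approx> x' * y'"
  using cong_mult_left cong_mult_right cong_trans by blast

lemma vertex_iff_dgr: "\<nu> \<in> paths \<Lambda> \<Longrightarrow> \<nu> \<in> vertices \<Lambda> \<longleftrightarrow> dgr \<Lambda> \<nu> = 0"
  by (simp add: vertices_def)

lemma relation_cong: "x - y \<in> kp_relations \<Lambda> \<Longrightarrow> x \<approx> y"
  by (simp add: kp_cong_def kp_ideal.relation)

section \<open>Products of generators, vertices included\<close>

lemma p_mult_p: "\<lbrakk>u \<in> vertices \<Lambda>; v \<in> vertices \<Lambda>\<rbrakk> \<Longrightarrow> kp_p u * kp_p v \<approx> (if u = v then kp_p u else 0)"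
  by (intro relation_cong kp_relations.KP1)

lemma p_rng_mult_s: "\<nu> \<in> paths \<Lambda> \<Longrightarrow> kp_p (rng \<Lambda> \<nu>) * kp_s \<Lambda> \<nu> \<approx> kp_s \<Lambda> \<nu>"
proof (cases "\<nu> \<in> vertices \<Lambda>")
  case True
  then show ?thesis
    using p_mult_p[of \<nu> \<nu>] by (simp add: vertex_rng_src kp_s_def)
qed (auto intro!: relation_cong kp_relations.KP2_path_rng)

lemma s_mult_p_src: "\<nu> \<in> paths \<Lambda> \<Longrightarrow> kp_s \<Lambda> \<nu> * kp_p (src \<Lambda> \<nu>) \<approx> kp_s \<Lambda> \<nu>"
proof (cases "\<nu> \<in> vertices \<Lambda>")
  case True
  then show ?thesis
    using p_mult_p[of \<nu> \<nu>] by (simp add: vertex_rng_src kp_s_def)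
qed (auto intro!: relation_cong kp_relations.KP2_path_src)

lemma p_src_mult_star: "\<nu> \<in> paths \<Lambda> \<Longrightarrow> kp_p (src \<Lambda> \<nu>) * kp_s_star \<Lambda> \<nu> \<approx> kp_s_star \<Lambda> \<nu>"
proof (cases "\<nu> \<in> vertices \<Lambda>")
  case True
  then show ?thesis
    using p_mult_p[of \<nu> \<nu>] by (simp add: vertex_rng_src kp_s_star_def)
qed (auto intro!: relation_cong kp_relations.KP2_ghost_src)

lemma star_mult_p_rng: "\<nu> \<in> paths \<Lambda> \<Longrightarrow> kp_s_star \<Lambda> \<nu> * kp_p (rng \<Lambda> \<nu>) \<approx> kp_s_star \<Lambda> \<nu>"
proof (cases "\<nu> \<in> vertices \<Lambda>")
  case True
  then show ?thesis
    using p_mult_p[of \<nu> \<nu>] by (simp add: vertex_rng_src kp_s_star_def)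
qed (auto intro!: relation_cong kp_relations.KP2_ghost_rng)

text \<open>The projections \<open>kp_p u\<close> and \<open>kp_p v\<close> can be inserted between
  \<open>x\<close> and \<open>y\<close>, and they are orthogonal.\<close>

lemma mult_vanish:
  assumes "x * kp_p u \<approx> x" "kp_p v * y \<approx> y" "u \<noteq> v" "u \<in> vertices \<Lambda>" "v \<in> vertices \<Lambda>"
    and "x \<in> kp_free \<Lambda>" "y \<in> kp_free \<Lambda>"
  shows "x * y \<approx> 0"
proof -
  have "x * y \<approx> (x * kp_p u) * (kp_p v * y)"
    using assms by (intro cong_mult cong_sym[OF assms(1)] cong_sym[OF assms(2)]) (auto intro!: kp_free_intros)
  also have "\<dots> = x * (kp_p u * kp_p v) * y"
    by (simp add: mult.assoc)
  also have "\<dots> \<approx> x * 0 * y"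
    using assms p_mult_p[of u v] by (intro cong_mult_right cong_mult_left) auto
  finally show ?thesis by simp
qed

text \<open>KP2 is imposed for paths of nonzero degree. A vertex acts as an identity on a composable
  path, and a product of paths that do not compose vanishes through the orthogonal projections
  between them.\<close>

lemma s_mult_s:
  assumes "\<nu> \<in> paths \<Lambda>" "\<mu> \<in> paths \<Lambda>"
  shows "kp_s \<Lambda> \<nu> * kp_s \<Lambda> \<mu> \<approx> (if src \<Lambda> \<nu> = rng \<Lambda> \<mu> then kp_s \<Lambda> (cmp \<Lambda> \<nu> \<mu>) else 0)"
proof (cases "src \<Lambda> \<nu> = rng \<Lambda> \<mu>")
  case True
  consider "\<nu> \<in> vertices \<Lambda>" | "\<mu> \<in> vertices \<Lambda>" | "\<nu> \<notin> vertices \<Lambda>" "\<mu> \<notin> vertices \<Lambda>" by blast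
  then show ?thesis
  proof cases
    case 1
    then have \<nu>: "\<nu> = rng \<Lambda> \<mu>" using True by (simp add: vertex_rng_src)
    then have "cmp \<Lambda> \<nu> \<mu> = \<mu>" using cmp_rng[OF assms(2)] by simp
    then show ?thesis
      using p_rng_mult_s[OF assms(2), folded \<nu>] 1 True by (simp add: kp_s_def[of _ \<nu>])
  next
    case 2
    then have "cmp \<Lambda> \<nu> \<mu> = \<nu>"
      using True cmp_src[OF assms(1)] by (simp add: vertex_rng_src)
    then show ?thesis
      using s_mult_p_src[OF assms(1)] 2 True by (simp add: kp_s_def[of _ \<mu>] vertex_rng_src)
  next
    case 3
    then show ?thesis
      using assms True by (auto intro!: relation_cong kp_relations.KP2_path)
  qed
next
  case False
  then show ?thesis
    using mult_vanish[OF s_mult_p_src[OF assms(1)] p_rng_mult_s[OF assms(2)] False] assms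
    by (simp add: rng_in_vertices src_in_vertices kp_s_in_free)
qed

lemma star_mult_star:
  assumes "\<nu> \<in> paths \<Lambda>" "\<mu> \<in> paths \<Lambda>"
  shows "kp_s_star \<Lambda> \<mu> * kp_s_star \<Lambda> \<nu> \<approx> (if src \<Lambda> \<nu> = rng \<Lambda> \<mu> then kp_s_star \<Lambda> (cmp \<Lambda> \<nu> \<mu>) else 0)"
proof (cases "src \<Lambda> \<nu> = rng \<Lambda> \<mu>")
  case True
  consider "\<nu> \<in> vertices \<Lambda>" | "\<mu> \<in> vertices \<Lambda>" | "\<nu> \<notin> vertices \<Lambda>" "\<mu> \<notin> vertices \<Lambda>" by blast
  then show ?thesis
  proof cases
    case 1
    then have \<nu>: "\<nu> = rng \<Lambda> \<mu>" using True by (simp add: vertex_rng_src)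
    then have "cmp \<Lambda> \<nu> \<mu> = \<mu>" using cmp_rng[OF assms(2)] by simp
    then show ?thesis
      using star_mult_p_rng[OF assms(2), folded \<nu>] 1 True by (simp add: kp_s_star_def[of _ \<nu>])
  next
    case 2
    then have "cmp \<Lambda> \<nu> \<mu> = \<nu>"
      using True cmp_src[OF assms(1)] by (simp add: vertex_rng_src)
    then show ?thesis
      using p_src_mult_star[OF assms(1)] 2 True by (simp add: kp_s_star_def[of _ \<mu>] vertex_rng_src)
  next
    case 3
    then show ?thesis
      using assms True by (auto intro!: relation_cong kp_relations.KP2_ghost)
  qed
next
  case False
  then show ?thesis
    using mult_vanish[OF star_mult_p_rng[OF assms(2)] p_src_mult_star[OF assms(1)]] assms
    by (simp add: rng_in_vertices src_in_vertices kp_s_star_in_free)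
qed

lemma star_mult_s:
  assumes "\<nu> \<in> paths \<Lambda>" "\<mu> \<in> paths \<Lambda>" "dgr \<Lambda> \<nu> = dgr \<Lambda> \<mu>"
  shows "kp_s_star \<Lambda> \<nu> * kp_s \<Lambda> \<mu> \<approx> (if \<nu> = \<mu> then kp_p (src \<Lambda> \<nu>) else 0)"
proof (cases "\<nu> \<in> vertices \<Lambda>")
  case True
  then have "\<mu> \<in> vertices \<Lambda>"
    using assms by (simp add: vertex_iff_dgr)
  then show ?thesis
    using p_mult_p[of \<nu> \<mu>] True by (simp add: kp_s_def kp_s_star_def vertex_rng_src split: if_splits)
next
  case False
  then have "\<mu> \<notin> vertices \<Lambda>"
    using assms by (simp add: vertex_iff_dgr)
  then show ?thesis
    using assms False by (intro relation_cong kp_relations.KP3) auto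
qed

text \<open>KP4 excludes degree 0. There the only path is \<open>v\<close> itself, and the sum is
  \<open>kp_p v * kp_p v\<close>, which KP1 handles.\<close>

lemma p_eq_sum:
  assumes "v \<in> vertices \<Lambda>"
  shows "kp_p v \<approx> (\<Sum>\<nu>\<in>paths_from \<Lambda> v n. kp_s \<Lambda> \<nu> * kp_s_star \<Lambda> \<nu>)"
proof (cases "n = 0")
  case True
  have "\<nu> = v" if "\<nu> \<in> paths_from \<Lambda> v 0" for \<nu>
  proof -
    have "\<nu> \<in> vertices \<Lambda>" "rng \<Lambda> \<nu> = v"
      using that by (simp_all add: paths_from_def vertices_def)
    then show ?thesis
      using vertex_rng_src(1) by simp
  qed
  moreover have "v \<in> paths_from \<Lambda> v 0"
    using assms vertex_rng_src(1)[OF assms] by (simp add: paths_from_def vertices_def)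
  ultimately have "paths_from \<Lambda> v 0 = {v}"
    by blast
  then show ?thesis
    using assms True cong_sym[OF p_mult_p[of v v]] by (simp add: kp_s_def kp_s_star_def)
next
  case False
  then show ?thesis
    using assms by (intro relation_cong kp_relations.KP4)
qed

text \<open>Cut \<open>\<nu>\<close> after degree \<open>dgr \<Lambda> \<mu>\<close>. KP3 compares
  the first piece with \<open>\<mu>\<close>: either the product vanishes or the remaining piece of
  degree \<open>m\<close> survives.\<close>

lemma star_mult_s_longer:
  assumes "\<mu> \<in> paths \<Lambda>" "\<nu> \<in> paths \<Lambda>" "dgr \<Lambda> \<nu> = dgr \<Lambda> \<mu> + m"
  shows "\<exists>z. kp_s_star \<Lambda> \<mu> * kp_s \<Lambda> \<nu> \<approx> z \<and> (z = 0 \<or> (\<exists>\<beta>\<in>paths \<Lambda>. dgr \<Lambda> \<beta> = m \<and> z = kp_s \<Lambda> \<beta>))"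
proof -
  obtain \<alpha> \<beta> where ab: "\<alpha> \<in> paths \<Lambda>" "\<beta> \<in> paths \<Lambda>" "src \<Lambda> \<alpha> = rng \<Lambda> \<beta>" "dgr \<Lambda> \<alpha> = dgr \<Lambda> \<mu>" "dgr \<Lambda> \<beta> = m"
    "\<nu> = cmp \<Lambda> \<alpha> \<beta>" "src \<Lambda> \<beta> = src \<Lambda> \<nu>"
    using factorE[OF assms(2,3)] by metis
  have "kp_s_star \<Lambda> \<mu> * kp_s \<Lambda> \<nu> \<approx> kp_s_star \<Lambda> \<mu> * (kp_s \<Lambda> \<alpha> * kp_s \<Lambda> \<beta>)"
    using s_mult_s[OF ab(1,2)] ab(3,6) assms(1)
    by (intro cong_mult_left) (auto intro: kp_free_intros cong_sym)
  also have "\<dots> = (kp_s_star \<Lambda> \<mu> * kp_s \<Lambda> \<alpha>) * kp_s \<Lambda> \<beta>"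
    by (simp add: mult.assoc)
  also have "\<dots> \<approx> (if \<mu> = \<alpha> then kp_p (src \<Lambda> \<mu>) else 0) * kp_s \<Lambda> \<beta>"
    using star_mult_s[OF assms(1) ab(1)] ab(2,4) by (intro cong_mult_right) (auto intro: kp_free_intros)
  also have "\<dots> \<approx> (if \<mu> = \<alpha> then kp_s \<Lambda> \<beta> else 0)"
    by (simp add: p_rng_mult_s[OF ab(2)] ab(3))
  finally show ?thesis
    using ab(2,5) by (intro exI[of _ "if \<mu> = \<alpha> then kp_s \<Lambda> \<beta> else 0"]) auto
qed

lemma star_longer_mult_s:
  assumes "\<mu> \<in> paths \<Lambda>" "\<nu> \<in> paths \<Lambda>" "dgr \<Lambda> \<nu> = dgr \<Lambda> \<mu> + m"
  shows "\<exists>z. kp_s_star \<Lambda> \<nu> * kp_s \<Lambda> \<mu> \<approx> z \<and> (z = 0 \<or> (\<exists>\<beta>\<in>paths \<Lambda>. dgr \<Lambda> \<beta> = m \<and> z = kp_s_star \<Lambda> \<beta>))"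
proof -
  obtain \<alpha> \<beta> where ab: "\<alpha> \<in> paths \<Lambda>" "\<beta> \<in> paths \<Lambda>" "src \<Lambda> \<alpha> = rng \<Lambda> \<beta>" "dgr \<Lambda> \<alpha> = dgr \<Lambda> \<mu>" "dgr \<Lambda> \<beta> = m"
    "\<nu> = cmp \<Lambda> \<alpha> \<beta>" "src \<Lambda> \<beta> = src \<Lambda> \<nu>"
    using factorE[OF assms(2,3)] by metis
  have "kp_s_star \<Lambda> \<nu> * kp_s \<Lambda> \<mu> \<approx> (kp_s_star \<Lambda> \<beta> * kp_s_star \<Lambda> \<alpha>) * kp_s \<Lambda> \<mu>"
    using star_mult_star[OF ab(1,2)] ab(3,6) assms(1)
    by (intro cong_mult_right) (auto intro: kp_free_intros cong_sym)
  also have "\<dots> = kp_s_star \<Lambda> \<beta> * (kp_s_star \<Lambda> \<alpha> * kp_s \<Lambda> \<mu>)"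
    by (simp add: mult.assoc)
  also have "\<dots> \<approx> kp_s_star \<Lambda> \<beta> * (if \<alpha> = \<mu> then kp_p (src \<Lambda> \<alpha>) else 0)"
    using star_mult_s[OF ab(1) assms(1)] ab(2,4) by (intro cong_mult_left) (auto intro: kp_free_intros)
  also have "\<dots> \<approx> (if \<alpha> = \<mu> then kp_s_star \<Lambda> \<beta> else 0)"
    unfolding ab(3) by (simp add: star_mult_p_rng[OF ab(2)])
  finally show ?thesis
    using ab(2,5) by (intro exI[of _ "if \<alpha> = \<mu> then kp_s_star \<Lambda> \<beta> else 0"]) auto
qed

end

section \<open>The quotient algebra\<close>

text \<open>The parameter \<open>field_type\<close> only fixes the coefficient field.\<close>

locale kp_setting = k_graph \<Lambda> for \<Lambda> :: "('a, 'k::finite) kgraph" +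
  fixes field_type :: "'f::field itself"
  assumes row_finite: "row_finite_no_sources \<Lambda>"
    and finite_vertices: "finite (vertices \<Lambda>)"
begin

abbreviation p :: "'a \<Rightarrow> 'a kp_gen free_word \<Rightarrow>\<^sub>0 'f" where "p \<equiv> kp_p"
abbreviation s :: "'a \<Rightarrow> 'a kp_gen free_word \<Rightarrow>\<^sub>0 'f" where "s \<equiv> kp_s \<Lambda>"
abbreviation t :: "'a \<Rightarrow> 'a kp_gen free_word \<Rightarrow>\<^sub>0 'f" where "t \<equiv> kp_s_star \<Lambda>"
abbreviation F :: "('a kp_gen free_word \<Rightarrow>\<^sub>0 'f) set" where "F \<equiv> kp_free \<Lambda>"
abbreviation K :: "('f, ('a kp_gen free_word \<Rightarrow>\<^sub>0 'f) set) module" where "K \<equiv> kumjian_pask \<Lambda>"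
abbreviation cls :: "('a kp_gen free_word \<Rightarrow>\<^sub>0 'f) \<Rightarrow> ('a kp_gen free_word \<Rightarrow>\<^sub>0 'f) set"
  where "cls \<equiv> kp_class \<Lambda>"
abbreviation R :: "'f ring" where "R \<equiv> ring_of_type_algebra"
abbreviation scalar :: "'f \<Rightarrow> 'a kp_gen free_word \<Rightarrow>\<^sub>0 'f" where "scalar \<equiv> Poly_Mapping.single 0"
abbreviation unit :: "'a kp_gen free_word \<Rightarrow>\<^sub>0 'f" where "unit \<equiv> \<Sum>v\<in>vertices \<Lambda>. p v"

section \<open>Cosets and their representatives\<close>

lemma cls_eq: "cls x = {y. y \<approx> x}"
  by (auto simp: kp_class_def a_r_coset_def r_coset_def kp_free_ring_def kp_cong_def
      intro!: bexI[of _ "_ - x"])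

lemma cls_eq_iff: "cls x = cls y \<longleftrightarrow> x \<approx> y"
  unfolding cls_eq using cong_refl cong_sym cong_trans by blast

lemma in_cls: "x \<in> cls x"
  by (simp add: cls_eq)

lemma cong_in_free: "x \<approx> y \<Longrightarrow> y \<in> F \<Longrightarrow> x \<in> F"
  unfolding kp_cong_def by (metis kp_ideal_subset_free kp_free_add diff_add_cancel)

lemma carrier_K: "carrier K = cls ` F"
  by (auto simp: kumjian_pask_def Let_def FactRing_def A_RCOSETS_def RCOSETS_def kp_class_def
      a_r_coset_def kp_free_ring_def)

text \<open>The product of cosets is a union over all representatives; congruence makes every member
  of this union the same coset. A representative of the class of an element of \<open>F\<close> lies
  in \<open>F\<close> again, as \<open>cong_mult\<close> requires.\<close>

lemma mult_K: "x \<in> F \<Longrightarrow> y \<in> F \<Longrightarrow> cls x \<otimes>\<^bsub>K\<^esub> cls y = cls (x * y)"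
proof -
  assume x: "x \<in> F" and y: "y \<in> F"
  have "cls x \<otimes>\<^bsub>K\<^esub> cls y = (\<Union>a\<in>cls x. \<Union>b\<in>cls y. cls (a * b))"
    by (simp add: kumjian_pask_def Let_def FactRing_def rcoset_mult_def kp_class_def kp_free_ring_def)
  also have "\<dots> = (\<Union>a\<in>cls x. \<Union>b\<in>cls y. cls (x * y))"
  proof (intro SUP_cong refl)
    fix a b assume "a \<in> cls x" "b \<in> cls y"
    then have "a * b \<approx> x * y"
      using x y by (intro cong_mult) (auto simp: cls_eq intro: cong_in_free)
    then show "cls (a * b) = cls (x * y)"
      by (simp add: cls_eq_iff)
  qed
  also have "\<dots> = cls (x * y)"
    using in_cls by blast
  finally show ?thesis .
qed

lemma add_K: "cls x \<oplus>\<^bsub>K\<^esub> cls y = cls (x + y)"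
proof -
  have "cls x \<oplus>\<^bsub>K\<^esub> cls y = {a + b | a b. a \<in> cls x \<and> b \<in> cls y}"
    by (auto simp: kumjian_pask_def Let_def FactRing_def set_add_def set_mult_def kp_free_ring_def)
  also have "\<dots> = cls (x + y)"
  proof (intro equalityI subsetI)
    fix z assume "z \<in> cls (x + y)"
    then have "z - y \<approx> x"
      by (simp add: cls_eq kp_cong_def algebra_simps)
    then have "z = (z - y) + y \<and> z - y \<in> cls x \<and> y \<in> cls y"
      by (simp add: cls_eq)
    then show "z \<in> {a + b | a b. a \<in> cls x \<and> b \<in> cls y}"
      by blast
  qed (auto simp: cls_eq intro: cong_add)
  finally show ?thesis .
qed

lemma zero_K: "\<zero>\<^bsub>K\<^esub> = cls 0"
  by (auto simp: kumjian_pask_def Let_def FactRing_def cls_eq kp_cong_def)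

lemma one_K: "\<one>\<^bsub>K\<^esub> = cls unit"
  by (simp add: kumjian_pask_def Let_def FactRing_def kp_class_def kp_free_ring_def)

lemma smult_K: "c \<odot>\<^bsub>K\<^esub> cls x = cls (scalar c * x)"
proof -
  have "c \<odot>\<^bsub>K\<^esub> cls x = (\<Union>a\<in>cls x. cls (scalar c * a))"
    by (simp add: kumjian_pask_def Let_def)
  also have "\<dots> = (\<Union>a\<in>cls x. cls (scalar c * x))"
    by (intro SUP_cong refl) (auto simp: cls_eq_iff, auto simp: cls_eq intro: cong_scale)
  also have "\<dots> = cls (scalar c * x)"
    using in_cls by blast
  finally show ?thesis .
qed

lemma unit_in_free: "unit \<in> F"
  by (auto intro: kp_free_intros)

text \<open>Only the product with \<open>u = v\<close> survives, so an element fixed by one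
  projection is fixed by their sum.\<close>

lemma sum_p_mult:
  assumes "v \<in> vertices \<Lambda>" "p v * x \<approx> x" "x \<in> F"
  shows "unit * x \<approx> x"
proof -
  have "unit * x \<approx> unit * (p v * x)"
    using assms cong_sym[OF assms(2)] unit_in_free by (intro cong_mult_left)
  also have "unit * (p v * x) = (\<Sum>u\<in>vertices \<Lambda>. p u * p v) * x"
    by (simp add: sum_distrib_right mult.assoc)
  also have "\<dots> \<approx> (\<Sum>u\<in>vertices \<Lambda>. if u = v then p u else 0) * x"
    using assms by (intro cong_mult_right cong_sum p_mult_p)
  also have "\<dots> = p v * x"
    using finite_vertices assms by (simp add: sum.delta)
  also note assms(2)
  finally show ?thesis .
qed

lemma mult_sum_p:
  assumes "v \<in> vertices \<Lambda>" "x * p v \<approx> x" "x \<in> F"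
  shows "x * unit \<approx> x"
proof -
  have "x * unit \<approx> (x * p v) * unit"
    using assms cong_sym[OF assms(2)] unit_in_free by (intro cong_mult_right)
  also have "(x * p v) * unit = x * (\<Sum>u\<in>vertices \<Lambda>. p v * p u)"
    by (simp add: sum_distrib_left mult.assoc)
  also have "\<dots> \<approx> x * (\<Sum>u\<in>vertices \<Lambda>. if v = u then p v else 0)"
    using assms by (intro cong_mult_left cong_sum p_mult_p)
  also have "\<dots> = x * p v"
    using finite_vertices assms by (simp add: sum.delta')
  also note assms(2)
  finally show ?thesis .
qed

text \<open>\<open>unit\<close> meets the leftmost letter, and letters appended on the right
  preserve the law by associativity.\<close>

lemma unit_mult: "x \<in> F \<Longrightarrow> unit * x \<approx> x"
proof (induction x rule: kp_free_induct)
  case (add x y)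
  then show ?case
    using cong_add by (simp add: distrib_left)
next
  case (scale c x)
  have "unit * (scalar c * x) = scalar c * (unit * x)"
    by (metis mult.assoc single_0_mult_commute)
  then show ?case
    using scale cong_scale by simp
next
  case (s \<nu>)
  then show ?case
    by (intro sum_p_mult[OF rng_in_vertices p_rng_mult_s] kp_s_in_free)
next
  case (star \<nu>)
  then show ?case
    by (intro sum_p_mult[OF src_in_vertices p_src_mult_star] kp_s_star_in_free)
next
  case (mult_s x \<nu>)
  then show ?case
    using cong_mult_right[of "unit * x" x "s \<nu>"] by (simp add: mult.assoc kp_s_in_free)
next
  case (mult_star x \<nu>)
  then show ?case
    using cong_mult_right[of "unit * x" x "t \<nu>"] by (simp add: mult.assoc kp_s_star_in_free)
qed simp

text \<open>Here \<open>unit\<close> meets the letter appended last, and that letter absorbs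
  it.\<close>

lemma mult_unit: "x \<in> F \<Longrightarrow> x * unit \<approx> x"
proof (induction x rule: kp_free_induct)
  case (add x y)
  then show ?case
    using cong_add by (simp add: distrib_right)
next
  case (scale c x)
  then show ?case
    using cong_scale by (simp add: mult.assoc)
next
  case (s \<nu>)
  then show ?case
    by (intro mult_sum_p[OF src_in_vertices s_mult_p_src] kp_s_in_free)
next
  case (star \<nu>)
  then show ?case
    by (intro mult_sum_p[OF rng_in_vertices star_mult_p_rng] kp_s_star_in_free)
next
  case (mult_s x \<nu>)
  have "s \<nu> * unit \<approx> s \<nu>"
    using mult_s by (intro mult_sum_p[OF src_in_vertices s_mult_p_src] kp_s_in_free)
  then show ?case
    using cong_mult_left[of _ _ x] mult_s by (simp add: mult.assoc)
next
  case (mult_star x \<nu>)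
  have "t \<nu> * unit \<approx> t \<nu>"
    using mult_star by (intro mult_sum_p[OF rng_in_vertices star_mult_p_rng] kp_s_star_in_free)
  then show ?case
    using cong_mult_left[of _ _ x] mult_star by (simp add: mult.assoc)
qed simp

lemma abelian_group_K: "abelian_group K"
proof (rule abelian_groupI)
  fix x assume "x \<in> carrier K"
  then obtain a where "a \<in> F" "x = cls a"
    by (auto simp: carrier_K)
  then show "\<exists>y\<in>carrier K. y \<oplus>\<^bsub>K\<^esub> x = \<zero>\<^bsub>K\<^esub>"
    by (intro bexI[of _ "cls (- a)"]) (auto simp: carrier_K add_K zero_K intro: kp_free_intros)
qed (auto simp: carrier_K add_K zero_K ac_simps intro!: kp_free_intros)

lemma ring_K: "ring K"
proof (rule ringI)
  show "abelian_group K"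
    by (rule abelian_group_K)
  show "Group.monoid K"
    by (rule monoidI)
      (auto simp: carrier_K mult_K one_K mult.assoc unit_in_free kp_free_mult
        cls_eq_iff[THEN iffD2, OF unit_mult] cls_eq_iff[THEN iffD2, OF mult_unit])
qed (auto simp: carrier_K mult_K add_K distrib_left distrib_right kp_free_mult kp_free_add)

lemma R_simps: "carrier R = UNIV" "\<one>\<^bsub>R\<^esub> = 1" "\<zero>\<^bsub>R\<^esub> = 0" "a \<oplus>\<^bsub>R\<^esub> b = a + b" "a \<otimes>\<^bsub>R\<^esub> b = a * b"
  by (simp_all add: ring_of_type_algebra_def)

lemma assoc_algebra_K: "assoc_algebra R K"
proof (intro assoc_algebra.intro assoc_algebra_axioms.intro)
  show "Module.module R K"
  proof (rule moduleI)
    show "cring R" ..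
    show "abelian_group K"
      by (rule abelian_group_K)
  qed (auto simp: carrier_K R_simps smult_K add_K single_add distrib_left distrib_right mult_single
      simp flip: mult.assoc intro: kp_free_intros)
  show "ring K"
    by (rule ring_K)
next
  fix a x y assume "a \<in> carrier R" "x \<in> carrier K" "y \<in> carrier K"
  then show "(a \<odot>\<^bsub>K\<^esub> x) \<otimes>\<^bsub>K\<^esub> y = a \<odot>\<^bsub>K\<^esub> (x \<otimes>\<^bsub>K\<^esub> y)"
    by (auto simp: carrier_K smult_K mult_K kp_free_scale mult.assoc)
next
  fix a x y assume "a \<in> carrier R" "x \<in> carrier K" "y \<in> carrier K"
  then obtain x' y' where "x = cls x'" "y = cls y'" "x' \<in> F" "y' \<in> F"
    by (auto simp: carrier_K)
  moreover have "x' * (scalar a * y') = scalar a * (x' * y')"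
    by (metis mult.assoc single_0_mult_commute)
  ultimately show "x \<otimes>\<^bsub>K\<^esub> (a \<odot>\<^bsub>K\<^esub> y) = a \<odot>\<^bsub>K\<^esub> (x \<otimes>\<^bsub>K\<^esub> y)"
    by (auto simp: smult_K mult_K kp_free_scale)
qed

sublocale K: assoc_algebra R K
  by (rule assoc_algebra_K)

lemma cls_sum: "(\<And>i. i \<in> A \<Longrightarrow> f i \<in> F) \<Longrightarrow> cls (sum f A) = (\<Oplus>\<^bsub>K\<^esub>i\<in>A. cls (f i))"
proof (induction A rule: infinite_finite_induct)
  case (insert i A)
  have "cls (sum f (insert i A)) = cls (f i) \<oplus>\<^bsub>K\<^esub> cls (sum f A)"
    using insert.hyps by (simp add: add_K)
  also have "\<dots> = cls (f i) \<oplus>\<^bsub>K\<^esub> (\<Oplus>\<^bsub>K\<^esub>i\<in>A. cls (f i))"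
    using insert by simp
  also have "\<dots> = (\<Oplus>\<^bsub>K\<^esub>i\<in>insert i A. cls (f i))"
    using insert by (intro K.M.finsum_insert[symmetric]) (auto simp: carrier_K)
  finally show ?case .
qed (auto simp: zero_K K.M.finsum_infinite)

end

section \<open>The grading\<close>

text \<open>Extended additively to words, this grades the free algebra; the relations are
  homogeneous for it, so the grading descends to the quotient.\<close>

fun letter_dgr :: "('a, 'k::finite) kgraph \<Rightarrow> 'a kp_gen \<Rightarrow> int ^ 'k" where
  "letter_dgr \<Lambda> (Vertex v) = 0"
| "letter_dgr \<Lambda> (Path \<nu>) = int_dgr \<Lambda> \<nu>"
| "letter_dgr \<Lambda> (Ghost \<nu>) = - int_dgr \<Lambda> \<nu>"

definition word_dgr :: "('a, 'k::finite) kgraph \<Rightarrow> 'a kp_gen free_word \<Rightarrow> int ^ 'k" where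
  "word_dgr \<Lambda> w = sum_list (map (letter_dgr \<Lambda>) (letters w))"

lemma word_dgr_plus: "word_dgr \<Lambda> (u + w) = word_dgr \<Lambda> u + word_dgr \<Lambda> w"
  by (simp add: word_dgr_def plus_free_word_def)

lemma word_dgr_0 [simp]: "word_dgr \<Lambda> 0 = 0"
  by (simp add: word_dgr_def zero_free_word_def)

definition hom_part :: "('a, 'k::finite) kgraph \<Rightarrow> int ^ 'k \<Rightarrow> ('a kp_gen free_word \<Rightarrow>\<^sub>0 'f::field) \<Rightarrow>
    ('a kp_gen free_word \<Rightarrow>\<^sub>0 'f)" where
  "hom_part \<Lambda> n x = Abs_poly_mapping (\<lambda>w. if word_dgr \<Lambda> w = n then Poly_Mapping.lookup x w else 0)"

lemma lookup_hom_part: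
  "Poly_Mapping.lookup (hom_part \<Lambda> n x) w = (if word_dgr \<Lambda> w = n then Poly_Mapping.lookup x w else 0)"
  unfolding hom_part_def
  by (subst lookup_Abs_poly_mapping) (auto intro: finite_subset[OF _ finite_lookup[of x]])

lemma hom_part_add: "hom_part \<Lambda> n (x + y) = hom_part \<Lambda> n x + hom_part \<Lambda> n y"
  by (rule poly_mapping_eqI) (simp add: lookup_hom_part lookup_add)

lemma hom_part_diff: "hom_part \<Lambda> n (x - y) = hom_part \<Lambda> n x - hom_part \<Lambda> n y"
  by (rule poly_mapping_eqI) (simp add: lookup_hom_part lookup_minus)

lemma hom_part_0 [simp]: "hom_part \<Lambda> n 0 = 0"
  by (rule poly_mapping_eqI) (simp add: lookup_hom_part)

lemma hom_part_sum: "hom_part \<Lambda> n (sum f A) = (\<Sum>i\<in>A. hom_part \<Lambda> n (f i))"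
  by (induction A rule: infinite_finite_induct) (simp_all add: hom_part_add)

lemma hom_part_single:
  "hom_part \<Lambda> n (Poly_Mapping.single w c) = (if word_dgr \<Lambda> w = n then Poly_Mapping.single w c else 0)"
  by (rule poly_mapping_eqI) (auto simp: lookup_hom_part lookup_single when_def)

lemma hom_part_mult_single:
  "hom_part \<Lambda> n (x * Poly_Mapping.single w c) = hom_part \<Lambda> (n - word_dgr \<Lambda> w) x * Poly_Mapping.single w c"
  by (subst (1 2) poly_mapping_expand[of x])
    (auto simp: sum_distrib_right hom_part_sum mult_single hom_part_single word_dgr_plus
      algebra_simps intro!: sum.cong)

lemma hom_part_single_mult:
  "hom_part \<Lambda> n (Poly_Mapping.single w c * x) = Poly_Mapping.single w c * hom_part \<Lambda> (n - word_dgr \<Lambda> w) x"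
  by (subst (1 2) poly_mapping_expand[of x])
    (auto simp: sum_distrib_left hom_part_sum mult_single hom_part_single word_dgr_plus
      algebra_simps intro!: sum.cong)

lemma hom_part_in_free: "x \<in> kp_free \<Lambda> \<Longrightarrow> hom_part \<Lambda> n x \<in> kp_free \<Lambda>"
  by (auto simp: kp_free_def in_keys_iff lookup_hom_part split: if_splits)

definition homogeneous :: "('a, 'k::finite) kgraph \<Rightarrow> int ^ 'k \<Rightarrow> ('a kp_gen free_word \<Rightarrow>\<^sub>0 'f::field) \<Rightarrow> bool" where
  "homogeneous \<Lambda> n x \<longleftrightarrow> (\<forall>w\<in>Poly_Mapping.keys x. word_dgr \<Lambda> w = n)"

lemma homogeneous_hom_part: "homogeneous \<Lambda> n x \<Longrightarrow> hom_part \<Lambda> m x = (if m = n then x else 0)"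
  by (rule poly_mapping_eqI) (auto simp: lookup_hom_part homogeneous_def in_keys_iff)

lemma hom_part_homogeneous: "homogeneous \<Lambda> n (hom_part \<Lambda> n x)"
  by (auto simp: homogeneous_def in_keys_iff lookup_hom_part split: if_splits)

lemma homogeneous_0: "homogeneous \<Lambda> n 0"
  by (simp add: homogeneous_def)

lemma homogeneous_diff: "homogeneous \<Lambda> n x \<Longrightarrow> homogeneous \<Lambda> n y \<Longrightarrow> homogeneous \<Lambda> n (x - y)"
  using keys_diff[of x y] by (auto simp: homogeneous_def)

lemma homogeneous_mult: "homogeneous \<Lambda> n x \<Longrightarrow> homogeneous \<Lambda> m y \<Longrightarrow> homogeneous \<Lambda> (n + m) (x * y)"
  using keys_mult[of x y] by (fastforce simp: homogeneous_def word_dgr_plus)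

lemma homogeneous_add: "homogeneous \<Lambda> n x \<Longrightarrow> homogeneous \<Lambda> n y \<Longrightarrow> homogeneous \<Lambda> n (x + y)"
  using keys_add[of x y] by (auto simp: homogeneous_def)

lemma homogeneous_scale: "homogeneous \<Lambda> n x \<Longrightarrow> homogeneous \<Lambda> n (Poly_Mapping.single 0 c * x)"
  using homogeneous_mult[of \<Lambda> 0 "Poly_Mapping.single 0 c" n x] by (simp add: homogeneous_def)

lemma homogeneous_sum: "(\<And>i. i \<in> A \<Longrightarrow> homogeneous \<Lambda> n (f i)) \<Longrightarrow> homogeneous \<Lambda> n (sum f A)"
  by (induction A rule: infinite_finite_induct) (auto simp: homogeneous_0 homogeneous_add)

lemma int_dgr_vertex: "v \<in> vertices \<Lambda> \<Longrightarrow> int_dgr \<Lambda> v = 0"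
  by (simp add: int_dgr_def vertices_def vec_eq_iff)

lemma kp_s_single: "kp_s \<Lambda> \<nu> = Poly_Mapping.single (Word [if \<nu> \<in> vertices \<Lambda> then Vertex \<nu> else Path \<nu>]) 1"
  by (simp add: kp_s_def kp_p_def)

lemma kp_s_star_single:
  "kp_s_star \<Lambda> \<nu> = Poly_Mapping.single (Word [if \<nu> \<in> vertices \<Lambda> then Vertex \<nu> else Ghost \<nu>]) 1"
  by (simp add: kp_s_star_def kp_p_def)

lemma word_dgr_path: "word_dgr \<Lambda> (Word [if \<nu> \<in> vertices \<Lambda> then Vertex \<nu> else Path \<nu>]) = int_dgr \<Lambda> \<nu>"
  by (simp add: word_dgr_def int_dgr_vertex)

lemma word_dgr_ghost: "word_dgr \<Lambda> (Word [if \<nu> \<in> vertices \<Lambda> then Vertex \<nu> else Ghost \<nu>]) = - int_dgr \<Lambda> \<nu>"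
  by (simp add: word_dgr_def int_dgr_vertex)

lemma homogeneous_s: "homogeneous \<Lambda> (int_dgr \<Lambda> \<nu>) (kp_s \<Lambda> \<nu>)"
  unfolding kp_s_single by (simp add: homogeneous_def word_dgr_path)

lemma homogeneous_star: "homogeneous \<Lambda> (- int_dgr \<Lambda> \<nu>) (kp_s_star \<Lambda> \<nu>)"
  unfolding kp_s_star_single by (simp add: homogeneous_def word_dgr_ghost)

lemma homogeneous_p: "homogeneous \<Lambda> 0 (kp_p v)"
  by (simp add: homogeneous_def kp_p_def word_dgr_def)

lemma hom_part_mult_s: "hom_part \<Lambda> n (x * kp_s \<Lambda> \<nu>) = hom_part \<Lambda> (n - int_dgr \<Lambda> \<nu>) x * kp_s \<Lambda> \<nu>"
  unfolding kp_s_single hom_part_mult_single word_dgr_path ..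

lemma hom_part_mult_star:
  "hom_part \<Lambda> n (x * kp_s_star \<Lambda> \<nu>) = hom_part \<Lambda> (n + int_dgr \<Lambda> \<nu>) x * kp_s_star \<Lambda> \<nu>"
  unfolding kp_s_star_single hom_part_mult_single word_dgr_ghost by simp

text \<open>With \<open>l\<close> as a separate variable the rule applies to a degree of any form
  and leaves the addition as a side condition.\<close>

lemma homogeneous_mult_degree:
  "homogeneous \<Lambda> n x \<Longrightarrow> homogeneous \<Lambda> m y \<Longrightarrow> l = n + m \<Longrightarrow> homogeneous \<Lambda> l (x * y)"
  using homogeneous_mult by blast

section \<open>Homogeneity of the ideal\<close>

context k_graph
begin

lemma int_dgr_cmp:
  "\<lbrakk>\<nu> \<in> paths \<Lambda>; \<mu> \<in> paths \<Lambda>; src \<Lambda> \<nu> = rng \<Lambda> \<mu>\<rbrakk> \<Longrightarrow> int_dgr \<Lambda> (cmp \<Lambda> \<nu> \<mu>) = int_dgr \<Lambda> \<nu> + int_dgr \<Lambda> \<mu>"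
  by (simp add: int_dgr_def dgr_cmp vec_eq_iff)

text \<open>KP1, KP3 and KP4 live in degree 0, KP3 because it compares paths of equal degree. The
  instances of KP2 carry the degree of the path or composite concerned, negated for ghosts.\<close>

lemma kp_relations_homogeneous:
  assumes "x \<in> kp_relations \<Lambda>"
  shows "\<exists>n. homogeneous \<Lambda> n x"
  using assms
proof cases
  case (KP1 u v)
  then show ?thesis
    by (intro exI[of _ 0]) (auto intro!: homogeneous_diff homogeneous_0 homogeneous_p
        homogeneous_mult_degree[OF homogeneous_p homogeneous_p])
next
  case (KP2_path \<nu> \<mu>)
  then show ?thesis
    using homogeneous_s[of \<Lambda> "cmp \<Lambda> \<nu> \<mu>"]
    by (intro exI[of _ "int_dgr \<Lambda> \<nu> + int_dgr \<Lambda> \<mu>"])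
      (auto intro!: homogeneous_diff homogeneous_mult homogeneous_s simp: int_dgr_cmp)
next
  case (KP2_ghost \<nu> \<mu>)
  then have "- int_dgr \<Lambda> (cmp \<Lambda> \<nu> \<mu>) = - int_dgr \<Lambda> \<mu> + - int_dgr \<Lambda> \<nu>"
    by (simp add: int_dgr_cmp)
  then show ?thesis
    unfolding KP2_ghost(1)
    by (intro exI[of _ "- int_dgr \<Lambda> (cmp \<Lambda> \<nu> \<mu>)"] homogeneous_diff homogeneous_star
        homogeneous_mult_degree[OF homogeneous_star homogeneous_star])
next
  case (KP2_path_rng \<nu>)
  then show ?thesis
    by (intro exI[of _ "int_dgr \<Lambda> \<nu>"])
      (auto intro!: homogeneous_diff homogeneous_s homogeneous_mult_degree[OF homogeneous_p homogeneous_s])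
next
  case (KP2_path_src \<nu>)
  then show ?thesis
    by (intro exI[of _ "int_dgr \<Lambda> \<nu>"])
      (auto intro!: homogeneous_diff homogeneous_s homogeneous_mult_degree[OF homogeneous_s homogeneous_p])
next
  case (KP2_ghost_src \<nu>)
  then show ?thesis
    by (intro exI[of _ "- int_dgr \<Lambda> \<nu>"])
      (auto intro!: homogeneous_diff homogeneous_star homogeneous_mult_degree[OF homogeneous_p homogeneous_star])
next
  case (KP2_ghost_rng \<nu>)
  then show ?thesis
    by (intro exI[of _ "- int_dgr \<Lambda> \<nu>"])
      (auto intro!: homogeneous_diff homogeneous_star homogeneous_mult_degree[OF homogeneous_star homogeneous_p])
next
  case (KP3 \<nu> \<mu>)
  then have "int_dgr \<Lambda> \<nu> = int_dgr \<Lambda> \<mu>"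
    by (simp add: int_dgr_def)
  then show ?thesis
    unfolding KP3(1)
    by (intro exI[of _ 0])
      (auto intro!: homogeneous_diff homogeneous_p homogeneous_0 homogeneous_mult_degree[OF homogeneous_star homogeneous_s])
next
  case (KP4 v n)
  then show ?thesis
    by (intro exI[of _ 0])
      (auto intro!: homogeneous_diff homogeneous_p homogeneous_sum homogeneous_mult_degree[OF homogeneous_s homogeneous_star])
qed

text \<open>The ideal is generated by homogeneous elements. A multiplier is split into its words,
  each of which merely shifts the degree; the hypothesis on \<open>x\<close> is then used in several
  degrees, so \<open>n\<close> is arbitrary in the induction.\<close>

lemma hom_part_in_ideal: "x \<in> kp_ideal \<Lambda> \<Longrightarrow> hom_part \<Lambda> n x \<in> kp_ideal \<Lambda>"
proof (induction arbitrary: n rule: kp_ideal.induct)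
  case (relation x)
  then obtain m where "homogeneous \<Lambda> m x"
    using kp_relations_homogeneous by blast
  then have "hom_part \<Lambda> n x = (if n = m then x else 0)"
    by (rule homogeneous_hom_part)
  then show ?case
    using relation by (auto intro: kp_ideal.intros)
next
  case (mult_left a x)
  have w: "Poly_Mapping.single w (Poly_Mapping.lookup a w) \<in> kp_free \<Lambda>" if "w \<in> Poly_Mapping.keys a" for w
    using mult_left.hyps(1) that by (intro kp_free_single) (auto simp: kp_free_def)
  have "hom_part \<Lambda> n (a * x) = (\<Sum>w\<in>Poly_Mapping.keys a.
      Poly_Mapping.single w (Poly_Mapping.lookup a w) * hom_part \<Lambda> (n - word_dgr \<Lambda> w) x)"
    by (subst poly_mapping_expand[of a]) (simp add: sum_distrib_right hom_part_sum hom_part_single_mult)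
  also have "\<dots> \<in> kp_ideal \<Lambda>"
    using w mult_left.IH by (intro kp_ideal_sum kp_ideal.mult_left)
  finally show ?case .
next
  case (mult_right x a)
  have w: "Poly_Mapping.single w (Poly_Mapping.lookup a w) \<in> kp_free \<Lambda>" if "w \<in> Poly_Mapping.keys a" for w
    using mult_right.hyps(2) that by (intro kp_free_single) (auto simp: kp_free_def)
  have "hom_part \<Lambda> n (x * a) = (\<Sum>w\<in>Poly_Mapping.keys a.
      hom_part \<Lambda> (n - word_dgr \<Lambda> w) x * Poly_Mapping.single w (Poly_Mapping.lookup a w))"
    by (subst poly_mapping_expand[of a]) (simp add: sum_distrib_left hom_part_sum hom_part_mult_single)
  also have "\<dots> \<in> kp_ideal \<Lambda>"
    using w mult_right.IH by (intro kp_ideal_sum kp_ideal.mult_right)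
  finally show ?case .
qed (auto simp: hom_part_add hom_part_single_mult intro: kp_ideal.intros)

lemma hom_part_cong: "x \<approx> y \<Longrightarrow> hom_part \<Lambda> n x \<approx> hom_part \<Lambda> n y"
  using hom_part_in_ideal unfolding kp_cong_def by (simp flip: hom_part_diff)

lemma int_dgr_eq: "dgr \<Lambda> \<nu> = dgr \<Lambda> \<mu> \<Longrightarrow> int_dgr \<Lambda> \<nu> = int_dgr \<Lambda> \<mu>"
  by (simp add: int_dgr_def)

end

section \<open>Homogeneous elements and the spanning products\<close>

context kp_setting
begin

text \<open>Spanning by the prescribed products, on the level of representatives. Closure under
  congruence allows membership to be checked after rewriting by the relations.\<close>

inductive_set kp_span :: "int ^ 'k \<Rightarrow> ('a kp_gen free_word \<Rightarrow>\<^sub>0 'f) set" for n where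
  base: "\<lbrakk>\<nu> \<in> paths \<Lambda>; \<mu> \<in> paths \<Lambda>; int_dgr \<Lambda> \<nu> - int_dgr \<Lambda> \<mu> = n\<rbrakk>
    \<Longrightarrow> s \<nu> * t \<mu> \<in> kp_span n"
| zero: "0 \<in> kp_span n"
| add: "\<lbrakk>x \<in> kp_span n; y \<in> kp_span n\<rbrakk> \<Longrightarrow> x + y \<in> kp_span n"
| scale: "x \<in> kp_span n \<Longrightarrow> scalar c * x \<in> kp_span n"
| congruent: "\<lbrakk>x \<in> kp_span n; y \<approx> x\<rbrakk> \<Longrightarrow> y \<in> kp_span n"

lemma kp_span_sum: "(\<And>i. i \<in> A \<Longrightarrow> f i \<in> kp_span n) \<Longrightarrow> sum f A \<in> kp_span n"
  by (induction A rule: infinite_finite_induct) (auto intro: kp_span.intros)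

lemma kp_span_s_star: "\<nu> \<in> paths \<Lambda> \<Longrightarrow> \<mu> \<in> paths \<Lambda> \<Longrightarrow> int_dgr \<Lambda> \<nu> - int_dgr \<Lambda> \<mu> = n \<Longrightarrow>
    x \<approx> s \<nu> * t \<mu> \<Longrightarrow> x \<in> kp_span n"
  by (rule kp_span.congruent[OF kp_span.base])

text \<open>
  Expanding the projection at the range of \<open>\<mu>\<close> by KP4 in degree \<open>d(\<mu>) + d(\<kappa>)\<close> makes both
  factors \<open>\<mu>\<^sup>*\<close> and \<open>\<kappa>\<close> absorbable.
\<close>

lemma s_star_mult_s_in_span:
  assumes \<nu>: "\<nu> \<in> paths \<Lambda>" and \<mu>: "\<mu> \<in> paths \<Lambda>" and \<kappa>: "\<kappa> \<in> paths \<Lambda>"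
    and n: "int_dgr \<Lambda> \<nu> - int_dgr \<Lambda> \<mu> + int_dgr \<Lambda> \<kappa> = n"
  shows "s \<nu> * t \<mu> * s \<kappa> \<in> kp_span n"
proof -
  define q where "q = dgr \<Lambda> \<mu> + dgr \<Lambda> \<kappa>"
  let ?P = "paths_from \<Lambda> (rng \<Lambda> \<mu>) q"
  have free: "s \<nu> * t \<mu> \<in> F" "s \<kappa> \<in> F"
    using assms by (auto intro: kp_free_intros)
  have "s \<nu> * t \<mu> * s \<kappa> \<approx> s \<nu> * (t \<mu> * p (rng \<Lambda> \<mu>)) * s \<kappa>"
    using cong_sym[OF star_mult_p_rng[OF \<mu>]] assms by (intro cong_mult_right cong_mult_left) (auto intro: kp_free_intros)
  also have "\<dots> = s \<nu> * t \<mu> * p (rng \<Lambda> \<mu>) * s \<kappa>"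
    by (simp add: mult.assoc)
  also have "\<dots> \<approx> s \<nu> * t \<mu> * (\<Sum>\<rho>\<in>?P. s \<rho> * t \<rho>) * s \<kappa>"
    using p_eq_sum[OF rng_in_vertices[OF \<mu>]] free by (intro cong_mult_right cong_mult_left)
  also have "\<dots> = (\<Sum>\<rho>\<in>?P. s \<nu> * (t \<mu> * s \<rho>) * (t \<rho> * s \<kappa>))"
    by (simp add: sum_distrib_left sum_distrib_right mult.assoc)
  finally have *: "s \<nu> * t \<mu> * s \<kappa> \<approx> \<dots>" .
  show ?thesis
  proof (rule kp_span.congruent[OF kp_span_sum *])
    fix \<rho> assume "\<rho> \<in> ?P"
    then have \<rho>: "\<rho> \<in> paths \<Lambda>" "dgr \<Lambda> \<rho> = dgr \<Lambda> \<mu> + dgr \<Lambda> \<kappa>" "dgr \<Lambda> \<rho> = dgr \<Lambda> \<kappa> + dgr \<Lambda> \<mu>"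
      by (simp_all add: paths_from_def q_def add.commute)
    obtain z where z: "t \<mu> * s \<rho> \<approx> z" "z = 0 \<or> (\<exists>\<beta>\<in>paths \<Lambda>. dgr \<Lambda> \<beta> = dgr \<Lambda> \<kappa> \<and> z = s \<beta>)"
      using star_mult_s_longer[OF \<mu> \<rho>(1,2)] by blast
    obtain y where y: "t \<rho> * s \<kappa> \<approx> y" "y = 0 \<or> (\<exists>\<beta>\<in>paths \<Lambda>. dgr \<Lambda> \<beta> = dgr \<Lambda> \<mu> \<and> y = t \<beta>)"
      using star_longer_mult_s[OF \<kappa> \<rho>(1,3)] by blast
    have "y \<in> F" "z \<in> F"
      using y(2) z(2) by (auto intro: kp_free_intros)
    then have c: "s \<nu> * (t \<mu> * s \<rho>) * (t \<rho> * s \<kappa>) \<approx> s \<nu> * z * y"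
      using z(1) y(1) assms \<rho>(1) by (intro cong_mult cong_refl) (auto intro!: kp_free_intros cong_mult_left)
    consider "z = 0 \<or> y = 0" | \<beta> \<gamma> where "\<beta> \<in> paths \<Lambda>" "dgr \<Lambda> \<beta> = dgr \<Lambda> \<kappa>" "z = s \<beta>"
      "\<gamma> \<in> paths \<Lambda>" "dgr \<Lambda> \<gamma> = dgr \<Lambda> \<mu>" "y = t \<gamma>"
      using z(2) y(2) by blast
    then have "s \<nu> * z * y \<in> kp_span n"
    proof cases
      case 1
      then show ?thesis
        by (auto intro: kp_span.zero)
    next
      case 2
      \<comment> \<open>As \<open>\<beta>\<close> and \<open>\<gamma>\<close> have the degrees of
        \<open>\<kappa>\<close> and \<open>\<mu>\<close>, the surviving product again has degree
        \<open>n\<close>.\<close>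
      have "s \<nu> * z * y \<approx> (if src \<Lambda> \<nu> = rng \<Lambda> \<beta> then s (cmp \<Lambda> \<nu> \<beta>) else 0) * t \<gamma>"
        unfolding 2(3,6) using s_mult_s[OF \<nu> 2(1)] 2(4) by (intro cong_mult_right) (auto intro: kp_free_intros)
      moreover have "\<dots> \<in> kp_span n"
        using \<nu> 2 n int_dgr_eq[OF 2(2)] int_dgr_eq[OF 2(5)]
        by (auto intro!: kp_span.base kp_span.zero cmp_closed simp: int_dgr_cmp)
      ultimately show ?thesis
        by (rule kp_span.congruent[rotated])
    qed
    then show "s \<nu> * (t \<mu> * s \<rho>) * (t \<rho> * s \<kappa>) \<in> kp_span n"
      using c by (rule kp_span.congruent)
  qed
qed

lemma kp_span_mult_s: "x \<in> kp_span n \<Longrightarrow> \<kappa> \<in> paths \<Lambda> \<Longrightarrow> m = n + int_dgr \<Lambda> \<kappa> \<Longrightarrow> x * s \<kappa> \<in> kp_span m"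
proof (induction rule: kp_span.induct)
  case (base \<nu> \<mu>)
  then show ?case
    by (intro s_star_mult_s_in_span) auto
next
  case (congruent x y)
  show ?case
    by (rule kp_span.congruent[OF congruent.IH[OF congruent.prems] cong_mult_right[OF congruent.hyps(2)]])
      (intro kp_s_in_free congruent.prems)
qed (auto simp: distrib_right mult.assoc intro: kp_span.intros)

text \<open>Two ghosts multiply to a single ghost or to zero, so the product has the required form
  at once.\<close>

lemma kp_span_mult_star:
  "x \<in> kp_span n \<Longrightarrow> \<kappa> \<in> paths \<Lambda> \<Longrightarrow> m = n - int_dgr \<Lambda> \<kappa> \<Longrightarrow> x * t \<kappa> \<in> kp_span m"
proof (induction rule: kp_span.induct)
  case (base \<nu> \<mu>)
  have "s \<nu> * t \<mu> * t \<kappa> \<approx>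
      s \<nu> * (if src \<Lambda> \<kappa> = rng \<Lambda> \<mu> then t (cmp \<Lambda> \<kappa> \<mu>) else 0)"
    unfolding mult.assoc using star_mult_star[OF base(4,2)] base(1)
    by (intro cong_mult_left) (auto intro: kp_free_intros)
  moreover have "\<dots> \<in> kp_span m"
    using base by (auto intro!: kp_span.base kp_span.zero cmp_closed simp: int_dgr_cmp)
  ultimately show ?case
    by (rule kp_span.congruent[rotated])
next
  case (congruent x y)
  show ?case
    by (rule kp_span.congruent[OF congruent.IH[OF congruent.prems] cong_mult_right[OF congruent.hyps(2)]])
      (intro kp_s_star_in_free congruent.prems)
qed (auto simp: distrib_right mult.assoc intro: kp_span.intros)

text \<open>This links degrees of words with the prescribed spanning set. A single generator takes
  the form \<open>s \<nu> * t \<mu>\<close> by inserting the vertex at its source; appended letters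
  are absorbed by \<open>kp_span_mult_s\<close> and \<open>kp_span_mult_star\<close>.\<close>

lemma hom_part_in_span: "x \<in> F \<Longrightarrow> hom_part \<Lambda> n x \<in> kp_span n"
proof (induction x arbitrary: n rule: kp_free_induct)
  case (s \<nu>)
  have span: "s \<nu> \<in> kp_span (int_dgr \<Lambda> \<nu>)"
  proof (rule kp_span_s_star)
    have "t (src \<Lambda> \<nu>) = p (src \<Lambda> \<nu>)"
      using src_in_vertices[OF s] by (simp add: kp_s_star_def)
    then show "s \<nu> \<approx> s \<nu> * t (src \<Lambda> \<nu>)"
      by (simp only:) (rule cong_sym[OF s_mult_p_src[OF s]])
  qed (use s src_in_vertices[OF s] in \<open>auto simp: src_closed int_dgr_vertex\<close>)
  show ?case
    by (simp add: homogeneous_hom_part[OF homogeneous_s] kp_span.zero span)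
next
  case (star \<nu>)
  have span: "t \<nu> \<in> kp_span (- int_dgr \<Lambda> \<nu>)"
  proof (rule kp_span_s_star)
    have "s (src \<Lambda> \<nu>) = p (src \<Lambda> \<nu>)"
      using src_in_vertices[OF star] by (simp add: kp_s_def)
    then show "t \<nu> \<approx> s (src \<Lambda> \<nu>) * t \<nu>"
      by (simp only:) (rule cong_sym[OF p_src_mult_star[OF star]])
  qed (use star src_in_vertices[OF star] in \<open>auto simp: src_closed int_dgr_vertex\<close>)
  show ?case
    by (simp add: homogeneous_hom_part[OF homogeneous_star] kp_span.zero span)
next
  case (mult_s x \<nu>)
  show ?case
    unfolding hom_part_mult_s using mult_s by (intro kp_span_mult_s) auto
next
  case (mult_star x \<nu>)
  show ?case
    unfolding hom_part_mult_star using mult_star by (intro kp_span_mult_star) auto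
qed (auto simp: hom_part_add hom_part_single_mult intro: kp_span.intros)

end

section \<open>Linear spans in modules\<close>

lemma (in Module.module) lin_span_submodule:
  assumes S: "S \<subseteq> carrier M"
  shows "submodule (lin_span R M S) R M"
proof (rule submoduleI)
  show "lin_span R M S \<subseteq> carrier M"
    using S by (auto simp: lin_span_def intro!: M.finsum_closed)
  show "\<zero>\<^bsub>M\<^esub> \<in> lin_span R M S"
    by (auto simp: lin_span_def intro!: exI[of _ "\<lambda>x. \<zero>"] exI[of _ "{}"])
  show smult: "a \<odot>\<^bsub>M\<^esub> x \<in> lin_span R M S" if a: "a \<in> carrier R" and "x \<in> lin_span R M S" for a x
  proof -
    obtain c T where c: "x = (\<Oplus>\<^bsub>M\<^esub>z\<in>T. c z \<odot>\<^bsub>M\<^esub> z)" "finite T" "T \<subseteq> S" "\<forall>z\<in>T. c z \<in> carrier R"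
      using \<open>x \<in> lin_span R M S\<close> by (auto simp: lin_span_def)
    have "a \<odot>\<^bsub>M\<^esub> x = (\<Oplus>\<^bsub>M\<^esub>z\<in>T. a \<odot>\<^bsub>M\<^esub> (c z \<odot>\<^bsub>M\<^esub> z))"
      using c S a by (auto intro!: finsum_smult_ldistr)
    also have "\<dots> = (\<Oplus>\<^bsub>M\<^esub>z\<in>T. (a \<otimes> c z) \<odot>\<^bsub>M\<^esub> z)"
      using c S a by (intro M.add.finprod_cong') (auto simp: smult_assoc1 subset_iff)
    finally have "a \<odot>\<^bsub>M\<^esub> x = (\<Oplus>\<^bsub>M\<^esub>z\<in>T. (a \<otimes> c z) \<odot>\<^bsub>M\<^esub> z)" .
    moreover have "\<forall>z\<in>T. a \<otimes> c z \<in> carrier R"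
      using c a by auto
    ultimately show ?thesis
      unfolding lin_span_def mem_Collect_eq using c(2,3) by (intro exI[of _ "\<lambda>z. a \<otimes> c z"] exI[of _ T] conjI)
  qed
  show "\<ominus>\<^bsub>M\<^esub> x \<in> lin_span R M S" if "x \<in> lin_span R M S" for x
  proof -
    have "x \<in> carrier M"
      using that S by (auto simp: lin_span_def intro!: M.finsum_closed)
    then have "\<ominus>\<^bsub>M\<^esub> x = (\<ominus> \<one>) \<odot>\<^bsub>M\<^esub> x"
      by (simp add: smult_l_minus)
    then show ?thesis
      using smult[of "\<ominus> \<one>" x] that by simp
  qed
  show "x \<oplus>\<^bsub>M\<^esub> y \<in> lin_span R M S" if xy: "x \<in> lin_span R M S" "y \<in> lin_span R M S" for x y
  proof -
    obtain c T where c: "x = (\<Oplus>\<^bsub>M\<^esub>z\<in>T. c z \<odot>\<^bsub>M\<^esub> z)" "finite T" "T \<subseteq> S" "\<forall>z\<in>T. c z \<in> carrier R"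
      using xy(1) by (auto simp: lin_span_def)
    obtain d U where d: "y = (\<Oplus>\<^bsub>M\<^esub>z\<in>U. d z \<odot>\<^bsub>M\<^esub> z)" "finite U" "U \<subseteq> S" "\<forall>z\<in>U. d z \<in> carrier R"
      using xy(2) by (auto simp: lin_span_def)
    \<comment> \<open>Extending the coefficients by zero brings both combinations to the common
      index set \<open>T \<union> U\<close>.\<close>
    define c' where "c' z = (if z \<in> T then c z else \<zero>)" for z
    define d' where "d' z = (if z \<in> U then d z else \<zero>)" for z
    have c'd': "c' z \<in> carrier R" "d' z \<in> carrier R" for z
      using c d by (auto simp: c'_def d'_def)
    have TU: "z \<in> carrier M" if "z \<in> T \<union> U" for z
      using that c d S by auto
    have x: "x = (\<Oplus>\<^bsub>M\<^esub>z\<in>T \<union> U. c' z \<odot>\<^bsub>M\<^esub> z)"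
      unfolding c(1) using c(2) d(2) TU c'd'
      by (intro M.add.finprod_mono_neutral_cong_left) (auto simp: c'_def)
    have y: "y = (\<Oplus>\<^bsub>M\<^esub>z\<in>T \<union> U. d' z \<odot>\<^bsub>M\<^esub> z)"
      unfolding d(1) using c(2) d(2) TU c'd'
      by (intro M.add.finprod_mono_neutral_cong_left) (auto simp: d'_def)
    have "x \<oplus>\<^bsub>M\<^esub> y = (\<Oplus>\<^bsub>M\<^esub>z\<in>T \<union> U. c' z \<odot>\<^bsub>M\<^esub> z \<oplus>\<^bsub>M\<^esub> d' z \<odot>\<^bsub>M\<^esub> z)"
      unfolding x y using TU c'd' by (intro M.finsum_addf[symmetric]) auto
    also have "\<dots> = (\<Oplus>\<^bsub>M\<^esub>z\<in>T \<union> U. (c' z \<oplus> d' z) \<odot>\<^bsub>M\<^esub> z)"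
      using TU c'd' by (intro M.add.finprod_cong') (auto simp: smult_l_distr)
    finally have "x \<oplus>\<^bsub>M\<^esub> y = (\<Oplus>\<^bsub>M\<^esub>z\<in>T \<union> U. (c' z \<oplus> d' z) \<odot>\<^bsub>M\<^esub> z)" .
    moreover have "finite (T \<union> U)" "T \<union> U \<subseteq> S" "\<forall>z\<in>T \<union> U. c' z \<oplus> d' z \<in> carrier R"
      using c(2,3) d(2,3) c'd' by auto
    ultimately show ?thesis
      unfolding lin_span_def mem_Collect_eq by (intro exI[of _ "\<lambda>z. c' z \<oplus> d' z"] exI[of _ "T \<union> U"] conjI)
  qed
qed

lemma (in Module.module) lin_span_base:
  assumes "S \<subseteq> carrier M" "x \<in> S"
  shows "x \<in> lin_span R M S"
proof -
  have "x = (\<Oplus>\<^bsub>M\<^esub>z\<in>{x}. \<one> \<odot>\<^bsub>M\<^esub> z)"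
    using assms by (subst M.finsum_insert) auto
  moreover have "finite {x}" "{x} \<subseteq> S" "\<forall>z\<in>{x}. \<one> \<in> carrier R"
    using assms by auto
  ultimately show ?thesis
    unfolding lin_span_def mem_Collect_eq by (intro exI[of _ "\<lambda>z. \<one>"] exI[of _ "{x}"] conjI)
qed

context kp_setting
begin

abbreviation component :: "int ^ 'k \<Rightarrow> ('a kp_gen free_word \<Rightarrow>\<^sub>0 'f) set set" where
  "component \<equiv> kp_component \<Lambda>"

section \<open>Directness of the sum of the components\<close>

lemma component_eq_lin_span:
  "component n = lin_span R K {cls (s \<nu> * t \<mu>) | \<nu> \<mu>. \<nu> \<in> paths \<Lambda> \<and> \<mu> \<in> paths \<Lambda> \<and> int_dgr \<Lambda> \<nu> - int_dgr \<Lambda> \<mu> = n}"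
proof -
  have "cls (s \<nu>) \<otimes>\<^bsub>K\<^esub> cls (t \<mu>) = cls (s \<nu> * t \<mu>)" if "\<nu> \<in> paths \<Lambda>" "\<mu> \<in> paths \<Lambda>" for \<nu> \<mu>
    using that by (simp add: mult_K kp_s_in_free kp_s_star_in_free)
  then show ?thesis
    unfolding kp_component_def by (intro arg_cong[of _ _ "lin_span R K"] Collect_cong) metis
qed

lemma component_gens_carrier:
  "{cls (s \<nu> * t \<mu>) | \<nu> \<mu>. \<nu> \<in> paths \<Lambda> \<and> \<mu> \<in> paths \<Lambda> \<and> int_dgr \<Lambda> \<nu> - int_dgr \<Lambda> \<mu> = n} \<subseteq> carrier K"
  by (auto simp: carrier_K intro: kp_free_intros)

lemma component_submodule: "submodule (component n) R K"
  unfolding component_eq_lin_span by (rule K.lin_span_submodule[OF component_gens_carrier])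

lemma cls_span_in_component: "x \<in> kp_span n \<Longrightarrow> cls x \<in> component n"
proof (induction rule: kp_span.induct)
  case (base \<nu> \<mu>)
  then show ?case
    unfolding component_eq_lin_span by (intro K.lin_span_base[OF component_gens_carrier]) blast
next
  case zero
  then show ?case
    using submodule.axioms(1)[OF component_submodule, THEN subgroup.one_closed] by (simp add: zero_K)
next
  case (add x y)
  then show ?case
    using K.submoduleE(5)[OF component_submodule] by (simp flip: add_K)
next
  case (scale x c)
  then show ?case
    using K.submoduleE(4)[OF component_submodule] by (simp add: R_simps flip: smult_K)
next
  case (congruent x y)
  then have "cls y = cls x"
    by (simp add: cls_eq_iff)
  then show ?case
    using congruent by simp
qed

text \<open>This form suits products and projections better than a span. The spanning products have
  homogeneous representatives; conversely a homogeneous \<open>x\<close> is its own part of degree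
  \<open>n\<close>, which \<open>hom_part_in_span\<close> covers.\<close>

lemma component_eq: "component n = cls ` {x \<in> F. homogeneous \<Lambda> n x}"
proof (intro equalityI subsetI)
  fix \<xi> assume "\<xi> \<in> component n"
  then obtain c T where \<xi>: "\<xi> = (\<Oplus>\<^bsub>K\<^esub>z\<in>T. c z \<odot>\<^bsub>K\<^esub> z)"
    and T: "T \<subseteq> {cls (s \<nu> * t \<mu>) | \<nu> \<mu>. \<nu> \<in> paths \<Lambda> \<and> \<mu> \<in> paths \<Lambda> \<and> int_dgr \<Lambda> \<nu> - int_dgr \<Lambda> \<mu> = n}"
    by (auto simp: component_eq_lin_span lin_span_def)
  have "\<exists>x. z = cls x \<and> x \<in> F \<and> homogeneous \<Lambda> n x" if z: "z \<in> T" for z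
  proof -
    obtain \<nu> \<mu> where "z = cls (s \<nu> * t \<mu>)" "\<nu> \<in> paths \<Lambda>" "\<mu> \<in> paths \<Lambda>" "n = int_dgr \<Lambda> \<nu> + - int_dgr \<Lambda> \<mu>"
      using T z by auto
    then show ?thesis
      by (intro exI[of _ "s \<nu> * t \<mu>"])
        (auto intro!: kp_free_intros homogeneous_mult_degree[OF homogeneous_s homogeneous_star])
  qed
  then obtain h where h: "\<And>z. z \<in> T \<Longrightarrow> z = cls (h z) \<and> h z \<in> F \<and> homogeneous \<Lambda> n (h z)"
    by metis
  have "\<xi> = (\<Oplus>\<^bsub>K\<^esub>z\<in>T. cls (scalar (c z) * h z))"
  proof -
    have "c z \<odot>\<^bsub>K\<^esub> z = cls (scalar (c z) * h z)" if "z \<in> T" for z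
      using h[OF that] smult_K by metis
    then show ?thesis
      unfolding \<xi> using h by (intro K.M.add.finprod_cong') (auto simp: carrier_K kp_free_scale)
  qed
  also have "\<dots> = cls (\<Sum>z\<in>T. scalar (c z) * h z)"
    using h by (intro cls_sum[symmetric]) (auto intro: kp_free_intros)
  finally show "\<xi> \<in> cls ` {x \<in> F. homogeneous \<Lambda> n x}"
    using h by (auto intro!: imageI kp_free_intros homogeneous_sum homogeneous_scale)
next
  fix \<xi> assume "\<xi> \<in> cls ` {x \<in> F. homogeneous \<Lambda> n x}"
  then obtain x where x: "\<xi> = cls x" "x \<in> F" "homogeneous \<Lambda> n x" by auto
  have "hom_part \<Lambda> n x = x"
    using homogeneous_hom_part[OF x(3), of n] by simp
  then show "\<xi> \<in> component n"
    using cls_span_in_component[OF hom_part_in_span[OF x(2), of n]] x(1) by simp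
qed

lemma sum_hom_part: "(\<Sum>n\<in>word_dgr \<Lambda> ` Poly_Mapping.keys x. hom_part \<Lambda> n x) = x"
  by (rule poly_mapping_eqI)
    (auto simp: lookup_sum lookup_hom_part sum.delta' in_keys_iff intro!: sum.neutral)

lemma hom_part_eq_0: "n \<notin> word_dgr \<Lambda> ` Poly_Mapping.keys x \<Longrightarrow> hom_part \<Lambda> n x = 0"
  by (rule poly_mapping_eqI) (auto simp: lookup_hom_part in_keys_iff image_iff)

text \<open>A decomposition is read off from the words of a representative. For uniqueness, another
  decomposition is lifted to homogeneous representatives and compared degree by degree; projecting
  respects the congruence because the ideal is homogeneous (\<open>hom_part_cong\<close>).\<close>

lemma component_direct_sum:
  assumes "\<xi> \<in> carrier K"
  shows "\<exists>!f. (\<forall>n. f n \<in> component n) \<and> finite {n. f n \<noteq> \<zero>\<^bsub>K\<^esub>} \<and> \<xi> = (\<Oplus>\<^bsub>K\<^esub>n\<in>{n. f n \<noteq> \<zero>\<^bsub>K\<^esub>}. f n)"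
proof -
  obtain x where x: "\<xi> = cls x" "x \<in> F"
    using assms by (auto simp: carrier_K)
  define f where "f n = cls (hom_part \<Lambda> n x)" for n
  have free: "hom_part \<Lambda> n x \<in> F" for n
    by (rule hom_part_in_free[OF x(2)])
  show ?thesis
  proof (intro ex1I[of _ f] conjI allI)
    show "f n \<in> component n" for n
      using free by (auto simp: f_def component_eq hom_part_homogeneous)
    \<comment> \<open>A part may be nonzero in the free algebra and zero in the quotient, so the
      support of \<open>f\<close> can be smaller than the set of degrees that occur.\<close>
    have sub: "{n. f n \<noteq> \<zero>\<^bsub>K\<^esub>} \<subseteq> word_dgr \<Lambda> ` Poly_Mapping.keys x"
      using hom_part_eq_0[of _ x] by (auto simp: f_def zero_K)
    then show "finite {n. f n \<noteq> \<zero>\<^bsub>K\<^esub>}"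
      by (rule finite_subset) simp
    have "\<xi> = cls (\<Sum>n\<in>word_dgr \<Lambda> ` Poly_Mapping.keys x. hom_part \<Lambda> n x)"
      by (simp add: sum_hom_part x)
    also have "\<dots> = (\<Oplus>\<^bsub>K\<^esub>n\<in>word_dgr \<Lambda> ` Poly_Mapping.keys x. f n)"
      unfolding f_def using free by (rule cls_sum)
    also have "\<dots> = (\<Oplus>\<^bsub>K\<^esub>n\<in>{n. f n \<noteq> \<zero>\<^bsub>K\<^esub>}. f n)"
      using sub free by (intro K.M.add.finprod_mono_neutral_cong_right) (auto simp: f_def carrier_K)
    finally show "\<xi> = (\<Oplus>\<^bsub>K\<^esub>n\<in>{n. f n \<noteq> \<zero>\<^bsub>K\<^esub>}. f n)" .
  next
    fix g assume g: "(\<forall>n. g n \<in> component n) \<and> finite {n. g n \<noteq> \<zero>\<^bsub>K\<^esub>} \<and> \<xi> = (\<Oplus>\<^bsub>K\<^esub>n\<in>{n. g n \<noteq> \<zero>\<^bsub>K\<^esub>}. g n)"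
    let ?A = "{n. g n \<noteq> \<zero>\<^bsub>K\<^esub>}"
    have "\<forall>n. \<exists>y. g n = cls y \<and> y \<in> F \<and> homogeneous \<Lambda> n y"
      using g by (auto simp: component_eq)
    then obtain h where h: "\<And>n. g n = cls (h n)" "\<And>n. h n \<in> F" "\<And>n. homogeneous \<Lambda> n (h n)"
      by metis
    have "cls x = cls (\<Sum>n\<in>?A. h n)"
      using g cls_sum[of ?A h] h x(1) by simp
    then have "x \<approx> (\<Sum>n\<in>?A. h n)"
      by (simp add: cls_eq_iff)
    then have cong: "hom_part \<Lambda> m x \<approx> (\<Sum>n\<in>?A. if m = n then h n else 0)" for m
      using hom_part_cong[of x "\<Sum>n\<in>?A. h n" m]
      by (simp add: hom_part_sum homogeneous_hom_part[OF h(3)])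
    show "g = f"
    proof
      fix m
      \<comment> \<open>Outside \<open>?A\<close> the value \<open>g m\<close> is zero, in agreement
        with the default 0.\<close>
      have "f m = cls (if m \<in> ?A then h m else 0)"
        using cong[of m] g by (simp add: f_def cls_eq_iff sum.delta)
      then show "g m = f m"
        using h(1)[of m] by (auto simp: zero_K)
    qed
  qed
qed

lemma graded_algebra_K: "graded_algebra R K component"
proof (intro graded_algebra.intro graded_algebra_axioms.intro)
  fix \<xi> \<eta> m n assume "\<xi> \<in> component m" "\<eta> \<in> component n"
  then show "\<xi> \<otimes>\<^bsub>K\<^esub> \<eta> \<in> component (m + n)"
    by (auto simp: component_eq mult_K intro!: imageI kp_free_intros homogeneous_mult)
qed (rule assoc_algebra_K component_submodule component_direct_sum; assumption?)+

end

section \<open>Homogeneous units\<close>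

context kp_setting
begin

text \<open>KP3 applies because all \<open>g a\<close> have one degree, injectivity of
  \<open>g\<close> leaves the diagonal, and equality of sources lets \<open>s (f a)\<close> absorb
  the projection. With the identity and \<sigma> as \<open>f\<close> and \<open>g\<close>, in either
  order, this yields both products of the unit with its inverse.\<close>

lemma sum_s_star_mult:
  assumes A: "finite A" and inj: "inj_on g A"
    and fg: "\<And>a. a \<in> A \<Longrightarrow> f a \<in> paths \<Lambda>" "\<And>a. a \<in> A \<Longrightarrow> g a \<in> paths \<Lambda>"
      "\<And>a. a \<in> A \<Longrightarrow> src \<Lambda> (f a) = src \<Lambda> (g a)" "\<And>a. a \<in> A \<Longrightarrow> dgr \<Lambda> (g a) = n"
  shows "(\<Sum>a\<in>A. s (f a) * t (g a)) * (\<Sum>a\<in>A. s (g a) * t (f a)) \<approx> (\<Sum>a\<in>A. s (f a) * t (f a))"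
proof -
  have "(\<Sum>a\<in>A. s (f a) * t (g a)) * (\<Sum>a\<in>A. s (g a) * t (f a)) =
      (\<Sum>a\<in>A. \<Sum>b\<in>A. s (f a) * (t (g a) * s (g b)) * t (f b))"
    by (simp add: sum_product mult.assoc)
  also have "\<dots> \<approx> (\<Sum>a\<in>A. \<Sum>b\<in>A. if a = b then s (f a) * t (f a) else 0)"
  proof (intro cong_sum)
    fix a b assume ab: "a \<in> A" "b \<in> A"
    have "s (f a) * (t (g a) * s (g b)) * t (f b) \<approx>
        s (f a) * (if g a = g b then p (src \<Lambda> (g a)) else 0) * t (f b)"
      using ab fg by (intro cong_mult_left cong_mult_right star_mult_s kp_s_in_free kp_s_star_in_free) auto
    also have "\<dots> = (if a = b then s (f a) * p (src \<Lambda> (f a)) * t (f a) else 0)"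
      using ab fg inj by (auto dest: inj_onD)
    also have "\<dots> \<approx> (if a = b then s (f a) * t (f a) else 0)"
    proof -
      have "s (f a) * p (src \<Lambda> (f a)) * t (f a) \<approx> s (f a) * t (f a)"
        using ab fg by (intro cong_mult_right s_mult_p_src kp_s_star_in_free)
      then show ?thesis by (cases "a = b") auto
    qed
    finally show "s (f a) * (t (g a) * s (g b)) * t (f b) \<approx> (if a = b then s (f a) * t (f a) else 0)" .
  qed
  also have "\<dots> = (\<Sum>a\<in>A. s (f a) * t (f a))"
    using A by (intro sum.cong refl) (simp add: sum.delta')
  finally show ?thesis .
qed

lemma paths_of_degree_eq: "paths_of_degree n = (\<Union>v\<in>vertices \<Lambda>. paths_from \<Lambda> v n)"
  by (auto simp: paths_of_degree_def paths_from_def rng_in_vertices)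

lemma finite_paths_of_degree: "finite (paths_of_degree n)"
  unfolding paths_of_degree_eq using row_finite finite_vertices by (auto simp: row_finite_no_sources_def)

text \<open>KP4 is applied at all vertices in the same degree; paths with different ranges are
  distinct, so the sums merge.\<close>

lemma unit_eq_sum: "(\<Sum>\<nu>\<in>paths_of_degree n. s \<nu> * t \<nu>) \<approx> unit"
proof -
  have "unit \<approx> (\<Sum>v\<in>vertices \<Lambda>. \<Sum>\<nu>\<in>paths_from \<Lambda> v n. s \<nu> * t \<nu>)"
    by (intro cong_sum p_eq_sum)
  also have "\<dots> = (\<Sum>\<nu>\<in>paths_of_degree n. s \<nu> * t \<nu>)"
    unfolding paths_of_degree_eq using row_finite finite_vertices
    by (intro sum.UNION_disjoint[symmetric]) (auto simp: row_finite_no_sources_def paths_from_def)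
  finally show ?thesis
    by (rule cong_sym)
qed

text \<open>Both signs are recorded because the inverse \<open>?w\<close> is itself homogeneous, of
  degree \<open>- d\<close>.\<close>

lemma homogeneous_units_of_bij:
  assumes bij: "bij_betw \<sigma> (paths_of_degree m) (paths_of_degree n)"
    and src: "\<And>\<nu>. \<nu> \<in> paths_of_degree m \<Longrightarrow> src \<Lambda> (\<sigma> \<nu>) = src \<Lambda> \<nu>"
    and d: "d = (\<chi> i. int (m $ i) - int (n $ i))"
  shows "\<exists>\<xi>\<in>component d. \<xi> \<in> Units K" "\<exists>\<xi>\<in>component (- d). \<xi> \<in> Units K"
proof -
  let ?P = "paths_of_degree m"
  let ?u = "\<Sum>\<nu>\<in>?P. s \<nu> * t (\<sigma> \<nu>)" and ?w = "\<Sum>\<nu>\<in>?P. s (\<sigma> \<nu>) * t \<nu>"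
  have \<sigma>: "\<sigma> \<nu> \<in> paths_of_degree n" if "\<nu> \<in> ?P" for \<nu>
    using bij that by (auto simp: bij_betw_def)
  have P: "\<nu> \<in> paths \<Lambda>" "\<sigma> \<nu> \<in> paths \<Lambda>" "dgr \<Lambda> \<nu> = m" "dgr \<Lambda> (\<sigma> \<nu>) = n" if "\<nu> \<in> ?P" for \<nu>
    using that \<sigma>[OF that] by (auto simp: paths_of_degree_def)
  have "?u * ?w \<approx> (\<Sum>\<nu>\<in>?P. s \<nu> * t \<nu>)"
    using P src bij by (intro sum_s_star_mult[of _ _ _ n] finite_paths_of_degree) (auto simp: bij_betw_def)
  then have uw: "?u * ?w \<approx> unit"
    using unit_eq_sum cong_trans by blast
  have "?w * ?u \<approx> (\<Sum>\<nu>\<in>?P. s (\<sigma> \<nu>) * t (\<sigma> \<nu>))"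
    using P src by (intro sum_s_star_mult[of _ _ _ m] finite_paths_of_degree) auto
  also have "\<dots> = (\<Sum>\<nu>\<in>paths_of_degree n. s \<nu> * t \<nu>)"
    using bij by (rule sum.reindex_bij_betw)
  also have "\<dots> \<approx> unit"
    by (rule unit_eq_sum)
  finally have wu: "?w * ?u \<approx> unit" .
  have free: "?u \<in> F" "?w \<in> F"
    using P by (auto intro!: kp_free_intros)
  have inv: "cls ?u \<otimes>\<^bsub>K\<^esub> cls ?w = \<one>\<^bsub>K\<^esub>" "cls ?w \<otimes>\<^bsub>K\<^esub> cls ?u = \<one>\<^bsub>K\<^esub>"
    using uw wu free by (simp_all add: mult_K one_K cls_eq_iff)
  have carrier: "cls ?u \<in> carrier K" "cls ?w \<in> carrier K"
    using free by (auto simp: carrier_K)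
  have deg: "int_dgr \<Lambda> \<nu> + - int_dgr \<Lambda> (\<sigma> \<nu>) = d" "int_dgr \<Lambda> (\<sigma> \<nu>) + - int_dgr \<Lambda> \<nu> = - d" if "\<nu> \<in> ?P" for \<nu>
    using P[OF that] by (simp_all add: d int_dgr_def vec_eq_iff)
  have "homogeneous \<Lambda> d ?u" "homogeneous \<Lambda> (- d) ?w"
    using deg by (auto intro!: homogeneous_sum homogeneous_mult_degree[OF homogeneous_s homogeneous_star])
  then have "cls ?u \<in> component d" "cls ?w \<in> component (- d)"
    using free by (auto simp: component_eq)
  then show "\<exists>\<xi>\<in>component d. \<xi> \<in> Units K" "\<exists>\<xi>\<in>component (- d). \<xi> \<in> Units K"
    using inv carrier unfolding Units_def by blast+
qed

lemma crossed_product_K: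
  assumes HNE: "HNE \<Lambda>" and HEDL: "HEDL \<Lambda>"
  shows "crossed_product R K component"
proof (intro crossed_product.intro crossed_product_axioms.intro graded_algebra_K)
  interpret graded_algebra R K component
    by (rule graded_algebra_K)
  define H where "H = {n. \<exists>\<xi>\<in>component n. \<xi> \<in> Units K}"
  have H_add: "m + n \<in> H" if "m \<in> H" "n \<in> H" for m n
    using that component_mult by (auto simp: H_def intro: K.Units_m_closed)
  have "\<one>\<^bsub>K\<^esub> \<in> component 0"
    unfolding one_K component_eq by (auto intro!: imageI unit_in_free homogeneous_sum homogeneous_p)
  then have H_0: "0 \<in> H"
    using K.Units_one_closed by (auto simp: H_def)
  have H_axis: "axis i 1 \<in> H" "axis i (-1) \<in> H" for i :: 'k
  proof -
    obtain N \<sigma> where \<sigma>: "bij_betw \<sigma> (paths_of_degree (axis i (Suc N))) (paths_of_degree (axis i N))"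
      "\<And>\<nu>. \<nu> \<in> paths_of_degree (axis i (Suc N)) \<Longrightarrow> src \<Lambda> (\<sigma> \<nu>) = src \<Lambda> \<nu>"
      using paths_of_degree_bij[OF row_finite finite_vertices HNE HEDL] by metis
    \<comment> \<open>\<open>N\<close> cancels: only the difference of the two lengths enters the
      degree.\<close>
    have d: "axis i 1 = (\<chi> j. int (axis i (Suc N) $ j) - int (axis i N $ j))"
      by (simp add: axis_def vec_eq_iff)
    have "- axis i 1 = axis i (-1::int)"
      by (simp add: axis_def vec_eq_iff)
    then show "axis i 1 \<in> H" "axis i (-1) \<in> H"
      using homogeneous_units_of_bij[OF \<sigma> d] by (simp_all add: H_def)
  qed
  \<comment> \<open>Integer induction moves up and down from 0, one step by \<open>axis i 1\<close>
    or \<open>axis i (-1)\<close>.\<close>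
  have H_axis_int: "axis i c \<in> H" for i c
  proof (induction c rule: int_induct[of _ 0])
    case base
    then show ?case
      using H_0 by (simp add: axis_def zero_vec_def)
  next
    case (step1 c)
    then show ?case
      using H_add[OF _ H_axis(1)] by (simp add: axis_add)
  next
    case (step2 c)
    then show ?case
      using H_add[OF _ H_axis(2)] by (metis axis_add diff_conv_add_uminus)
  qed
  have H_sum: "(\<Sum>i\<in>A. axis i (n $ i)) \<in> H" for A n
    by (induction A rule: infinite_finite_induct) (auto simp: H_0 H_add H_axis_int)
  fix n :: "int ^ 'k"
  have "n = (\<Sum>i\<in>UNIV. axis i (n $ i))"
    by (simp add: vec_eq_iff axis_def)
  then have "n \<in> H"
    using H_sum by metis
  then show "\<exists>\<xi>\<in>component n. \<xi> \<in> Units K"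
    by (simp add: H_def)
qed

end

theorem theorem5p2p9:
  fixes \<Lambda> :: "('a, 'k::finite) kgraph"
  assumes "k_graph \<Lambda>"
    and "row_finite_no_sources \<Lambda>"
    and "finite (vertices \<Lambda>)"
    and "HNE \<Lambda>"
    and "HEDL \<Lambda>"
  shows "crossed_product (ring_of_type_algebra :: 'f::field ring)
           (kumjian_pask \<Lambda>) (kp_component \<Lambda>)"
proof -
  interpret k_graph \<Lambda> by fact
  interpret kp_setting \<Lambda> "TYPE('f)"
    by unfold_locales fact+
  show ?thesis
    by (rule crossed_product_K) fact+
qed

end
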